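(* Consider the polling system with $K$ queues and an $I$-stage polling table operating under the binomial-exhaustive policy with parameter $\mathbf r\in\mathcal R$, as described in the context. Assume that the following two conditions hold: (a) For each $k\in\mathcal K$ there exists $\epsilon_k>0$ such that $\mathbb E[e^{tS_k}]<\infty$ for all $t\in(-\epsilon_k,\epsilon_k)$. (b) $\mathbb E[e^{tV_i}]<\infty$ for all $t\ge 0$ and all $i\in\mathcal I$. Then $\mathbb E[Q(A_i)^\ell]<\infty$ for all integers $\ell\ge1$ and all $i\in\mathcal I$, i.e. $\mathbb E[Q_k(A_i)^\ell]<\infty$ for every $k\in\mathcal K$, $i\in\mathcal I$ and $\ell\ge 1$.
   Context: Model. A single server attends $K$ queues, indexed by $\mathcal K=\{1,\dots,K\}$. Customers arrive at queue $k$ according to a Poisson process with rate $\lambda_k>0$ and wait in an infinite buffer. Service times at queue $k$ are i.i.d., distributed as a nonnegative random variable $S_k$ with mean $1/\mu_k<\infty$. The server visits queues according to a polling table with $I\ge K$ stages, $\mathcal I=\{1,\dots,I\}$; $p:\mathcal I\to\mathcal K$ maps a stage to the queue visited at that stage. Stages are visited cyclically $1,2,\dots,I,1,2,\dots$. Each transition from stage $i$ to the next stage (stage $I+1$ meaning stage $1$) incurs a switchover time distributed as a nonnegative random variable $V_i$ with finite mean $s_i$; $s:=\sum_{i\in\mathcal I}s_i>0$. All arrival processes, service times and switchover times are mutually independent. Put $\rho_k:=\lambda_k/\mu_k$, $\rho:=\sum_{k\in\mathcal K}\rho_k$, and assume $\rho<1$. Binomial-exhaustive policy (BEP). It has a parameter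 $\mathbf r=(r_1,\dots,r_I)\in\mathcal R:=\{\mathbf r\in[0,1]^I:\ \sum_{i\in\mathcal I:\,p(i)=k}r_i>0\text{ for all }k\in\mathcal K\}$. If the server finds $N$ customers in queue $p(i)$ at the start of a visit at stage $i$, then it serves queue $p(i)$ until its queue length is reduced to $N-Y_i(N,r_i)$, where $Y_i(N,r_i)$ is a binomial random variable with parameters $N$ and $r_i$, independent of everything else. (Equivalently, each of the $N$ customers is independently selected with probability $r_i$, and each selected customer generates an independent $M/G/1$ busy period with arrival rate $\lambda_{p(i)}$ and service times distributed as $S_{p(i)}$.) Steady state. The polling epoch of a stage is the starting time of the visit; a cycle is the time between consecutive polling epochs of stage $1$. $Q_k(t)$ is the number of customers in queue $k$ at time $t$ and $Q(t)=(Q_k(t))_{k\in\mathcal K}$. Since $\rho<1$, the chain of queue-length vectors embedded at the successive polling epochs of stage $1$ is an ergodic discrete-time Markov chain, and the system is considered in the corresponding steady state; $A_i$ denotes a generic polling epoch of stage $i$ in steady state, so $Q(A_i)$ has the stationary distribution of the queue-length vector at the polling epochs of stage $i$. *)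

theory Defs
  imports "HOL-Probability.Probability"
begin

text \<open>Homogeneous Poisson process, as a counting process \<open>N t\<close>, \<open>t \<ge> 0\<close>.\<close>

definition poisson_process :: "'w measure \<Rightarrow> real \<Rightarrow> (real \<Rightarrow> 'w \<Rightarrow> nat) \<Rightarrow> bool" where
  "poisson_process M rate N \<longleftrightarrow>
     (\<forall>t\<ge>0. N t \<in> measurable M (count_space UNIV)) \<and>
     (\<forall>w\<in>space M. N 0 w = 0) \<and>
     (\<forall>w\<in>space M. \<forall>s t. 0 \<le> s \<longrightarrow> s \<le> t \<longrightarrow> N s w \<le> N t w) \<and>
     (\<forall>w\<in>space M. \<forall>t\<ge>0. continuous (at_right t) (\<lambda>u. real (N u w))) \<and>
     (\<forall>s t. 0 \<le> s \<longrightarrow> s < t \<longrightarrow>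
        distr M (count_space UNIV) (\<lambda>w. N t w - N s w) = measure_pmf (poisson_pmf (rate * (t - s)))) \<and>
     (\<forall>t :: nat \<Rightarrow> real. 0 \<le> t 0 \<longrightarrow> mono t \<longrightarrow>
        prob_space.indep_vars M (\<lambda>_. count_space UNIV) (\<lambda>j w. N (t (Suc j)) w - N (t j) w) UNIV)"

text \<open>Law of a nonnegative random variable with finite mean \<open>m\<close>.\<close>

definition nonneg_law :: "real measure \<Rightarrow> real \<Rightarrow> bool" where
  "nonneg_law L m \<longleftrightarrow> prob_space L \<and> sets L = sets borel \<and> (AE x in L. 0 \<le> x) \<and>
     integrable L (\<lambda>x. x) \<and> (\<integral>x. x \<partial>L) = m"

datatype 'k source =
    Initial | Arrivals 'k | Service_time nat nat | Switchover nat | Selection nat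

text \<open>
  The queues are the elements of the finite type \<open>'k\<close>, the stages are \<open>1, \<dots>, I\<close>.
  Visits of the server are numbered \<open>0, 1, 2, \<dots>\<close>; visit \<open>n\<close> is made at stage \<open>n mod I + 1\<close>, and
  visit \<open>0\<close> starts at time \<open>0\<close>, which is thus a polling epoch of stage \<open>1\<close>.  The primitives are

  \<^item> \<open>X0\<close>: the queue lengths at time \<open>0\<close>;
  \<^item> \<open>N k t\<close>: the number of arrivals at queue \<open>k\<close> during \<open>(0, t]\<close>;
  \<^item> \<open>S n j\<close>: the duration of service number \<open>j\<close> (from \<open>0\<close>) in visit \<open>n\<close>;
  \<^item> \<open>V n\<close>: the switchover time after visit \<open>n\<close>;
  \<^item> \<open>Y n x\<close>: the binomial variable used in visit \<open>n\<close> if the server finds \<open>x\<close> customers.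
    Nothing is assumed about the joint law of \<open>Y n x\<close> for different \<open>x\<close>, only one of which is used.
\<close>

locale bep_polling = prob_space M
  for M :: "'w measure" +
  fixes I :: nat
    and p :: "nat \<Rightarrow> 'k :: finite"
    and lam :: "'k \<Rightarrow> real" and mu :: "'k \<Rightarrow> real"
    and S_law :: "'k \<Rightarrow> real measure"
    and s :: "nat \<Rightarrow> real"
    and V_law :: "nat \<Rightarrow> real measure"
    and r :: "nat \<Rightarrow> real"
    and X0 :: "'w \<Rightarrow> 'k \<Rightarrow> nat"
    and N :: "'k \<Rightarrow> real \<Rightarrow> 'w \<Rightarrow> nat"
    and S :: "nat \<Rightarrow> nat \<Rightarrow> 'w \<Rightarrow> real"
    and V :: "nat \<Rightarrow> 'w \<Rightarrow> real"
    and Y :: "nat \<Rightarrow> nat \<Rightarrow> 'w \<Rightarrow> nat"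
  assumes stages: "CARD('k) \<le> I"
    and lam_pos: "\<And>k. lam k > 0"
    and mu_pos: "\<And>k. mu k > 0"
    and service_law: "\<And>k. nonneg_law (S_law k) (1 / mu k)"
    and switchover_law: "\<And>i. i \<in> {1..I} \<Longrightarrow> nonneg_law (V_law i) (s i)"
    and total_switchover_pos: "(\<Sum>i\<in>{1..I}. s i) > 0"
    and stable: "(\<Sum>k\<in>UNIV. lam k / mu k) < 1"
    and r_range: "\<And>i. i \<in> {1..I} \<Longrightarrow> r i \<in> {0..1}"
    and r_pos: "\<And>k. (\<Sum>i\<in>{i\<in>{1..I}. p i = k}. r i) > 0"
    and X0_measurable: "X0 \<in> measurable M (count_space UNIV)"
    and arrivals: "\<And>k. poisson_process M (lam k) (N k)"
    and S_measurable: "\<And>n j. S n j \<in> borel_measurable M"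
    and S_nonneg: "\<And>n j w. w \<in> space M \<Longrightarrow> 0 \<le> S n j w"
    and S_distr: "\<And>n j. distr M borel (S n j) = S_law (p (n mod I + 1))"
    and V_measurable: "\<And>n. V n \<in> borel_measurable M"
    and V_nonneg: "\<And>n w. w \<in> space M \<Longrightarrow> 0 \<le> V n w"
    and V_distr: "\<And>n. distr M borel (V n) = V_law (n mod I + 1)"
    and Y_measurable: "\<And>n x. Y n x \<in> measurable M (count_space UNIV)"
    and Y_distr: "\<And>n x. distr M (count_space UNIV) (Y n x) =
          measure_pmf (binomial_pmf x (r (n mod I + 1)))"
    and independence: "indep_sets (\<lambda>src. case src of
            Initial \<Rightarrow> sigma_sets (space M) {X0 -` A \<inter> space M | A. A \<in> UNIV}
          | Arrivals k \<Rightarrow> sigma_sets (space M) {N k t -` A \<inter> space M | t A. 0 \<le> t}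
          | Service_time n j \<Rightarrow> sigma_sets (space M) {S n j -` A \<inter> space M | A. A \<in> sets borel}
          | Switchover n \<Rightarrow> sigma_sets (space M) {V n -` A \<inter> space M | A. A \<in> sets borel}
          | Selection n \<Rightarrow> sigma_sets (space M) {Y n x -` A \<inter> space M | x A. A \<in> UNIV})
          (UNIV :: 'k source set)"
begin

definition stage :: "nat \<Rightarrow> nat" where
  "stage n = n mod I + 1"

text \<open>Time of the \<open>m\<close>-th service completion of visit \<open>n\<close>, if the visit starts at time \<open>t\<close>
  and lasts for at least \<open>m\<close> services.\<close>

definition completion :: "nat \<Rightarrow> real \<Rightarrow> nat \<Rightarrow> 'w \<Rightarrow> real" where
  "completion n t m w = t + (\<Sum>j<m. S n j w)"

text \<open>
  Number of services in visit \<open>n\<close>, if it starts at time \<open>t\<close> with \<open>x\<close> customers in the visited queue: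
  the queue is served until its length is reduced to \<open>x - Y n x\<close>.  The queue length only decreases
  at service completions, by one, so the target is first reached at a completion, and the natural
  subtraction of \<open>m\<close> does not truncate up to that point.  Almost surely the target is reached,
  since the load of each queue is below \<open>1\<close>.
\<close>

definition services :: "nat \<Rightarrow> real \<Rightarrow> nat \<Rightarrow> 'w \<Rightarrow> nat" where
  "services n t x w = (let k = p (stage n) in
     LEAST m. x + (N k (completion n t m w) w - N k t w) - m \<le> x - Y n x w)"

text \<open>Starting time of visit \<open>n\<close> and queue lengths at that time.\<close>

primrec poll :: "nat \<Rightarrow> 'w \<Rightarrow> real \<times> ('k \<Rightarrow> nat)" where
  "poll 0 w = (0, X0 w)"
| "poll (Suc n) w =
     (let (t, q) = poll n w;
          m = services n t (q (p (stage n))) w;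
          t' = completion n t m w + V n w
      in (t', \<lambda>k. q k + (N k t' w - N k t w) - (if k = p (stage n) then m else 0)))"

definition polling_epoch :: "nat \<Rightarrow> 'w \<Rightarrow> real" where
  "polling_epoch n w = fst (poll n w)"

definition polling_queue :: "nat \<Rightarrow> 'w \<Rightarrow> 'k \<Rightarrow> nat" where
  "polling_queue n w = snd (poll n w)"

text \<open>
  Visits \<open>0\<close> and \<open>I\<close> start at consecutive polling epochs of stage \<open>1\<close>.  As \<open>X0\<close> is independent of
  the other primitives, \<open>steady_state\<close> says that the law of \<open>X0\<close> is a stationary distribution of the
  Markov chain embedded at the polling epochs of stage \<open>1\<close>.
\<close>

definition steady_state :: bool where
  "steady_state \<longleftrightarrow>
     distr M (count_space UNIV) (polling_queue I) = distr M (count_space UNIV) (polling_queue 0)"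

text \<open>Queue lengths at a polling epoch of stage \<open>i\<close>, taken in the cycle that starts at time \<open>0\<close>;
  in steady state all cycles are alike.\<close>

definition stage_queue :: "nat \<Rightarrow> 'w \<Rightarrow> 'k \<Rightarrow> nat" where
  "stage_queue i w = polling_queue (i - 1) w"

end

end

(*
  The weight of a queue-length vector q is the product of z_k^(q_k), where z_k = exp (eps / mu_k) is
  a small exponential of the workload that a customer brings.  Each customer selected at a visit is
  replaced by the arrivals during its busy period, and for small eps the expected weight of these is
  at most zeta_k < z_k: along the service completions of the visit, the weight is dominated by a
  supermartingale that decreases by a factor eta < 1 per service.  So one visit changes z_k into
  (1 - r) z_k + r zeta_k, at the price of a factor C for the switchover.  Since every queue has a
  stage with r > 0, a whole cycle maps the weight function into a constant times a weight function
  with strictly smaller bases, that is, E[W(Q') | Q = q] <= W(q) / 2 + D.  Truncating W and using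
  stationarity then gives E[W(Q)] <= 2 D, so all moments are finite.

  The Markov property needs no stopping times: conditionally on the number of services in each
  visit, the epochs are sums of service and switchover times, hence independent of the arrival
  processes.  Therefore the events are split into countably many traces, in each of which the
  numbers of arrivals during all services and switchovers are prescribed, and the probability of a
  trace is a product.
*)
theory Submission
  imports Defs
begin

section \<open>Preliminaries\<close>

text \<open>The number of services in a visit is a \<open>LEAST\<close> over a set that may be
  empty, and the expected weight may be infinite, so expectations after a visit are not computed
  directly. The estimates are inequalities \<open>emeasure \<nu> A \<le> ennreal (c * weight u q) *
  emeasure M A\<close> on sets \<open>A\<close> on which the state is constant, for an auxiliary
  measure \<open>\<nu>\<close> on the measurable sets of \<open>M\<close>. Such bounds propagate
  backwards in time: \<open>A\<close> is cut by the next numbers of arrivals, and the bounds of the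
  pieces add up to a probability generating function. With \<open>\<nu>\<close> the density of the
  final weight, the bound at the start becomes a bound of an expectation. With \<open>M\<close>
  itself, the same step gives a geometric tail for the number of services, hence termination almost
  surely; absolute continuity carries the exceptional null set over to \<open>\<nu>\<close>.

  The room for a factor below 1 comes from stability. To first order in the small parameter, a
  service at queue k adds (load - (1 - load) rho_k) / mu_k to the exponent of the weight, whereas
  the customer served was credited with load / mu_k.\<close>

lemma measurable_at_random_time:
  fixes N :: "real \<Rightarrow> 'a \<Rightarrow> nat"
  assumes N: "\<And>t. 0 \<le> t \<Longrightarrow> N t \<in> measurable M (count_space UNIV)"
    and rc: "\<And>w t. w \<in> space M \<Longrightarrow> 0 \<le> t \<Longrightarrow> continuous (at_right t) (\<lambda>u. real (N u w))"
    and T: "T \<in> borel_measurable P" and T_nonneg: "\<And>x. x \<in> space P \<Longrightarrow> 0 \<le> T x"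
    and h: "h \<in> measurable P M"
  shows "(\<lambda>x. N (T x) (h x)) \<in> measurable P (count_space UNIV)"
proof -
  \<comment> \<open>\<open>c m x\<close> is the first point of the grid of mesh
    \<open>1 / Suc m\<close> strictly to the right of \<open>T x\<close>. Strictness matters since
    \<open>at_right\<close> excludes the point itself; countability of the grid makes
    \<open>N (c m x) (h x)\<close> measurable.\<close>
  define c where "c m x = (real (nat \<lfloor>T x * real (Suc m)\<rfloor>) + 1) / real (Suc m)" for m x
  have c_meas: "(\<lambda>x. N (c m x) (h x)) \<in> measurable P (count_space UNIV)" for m
    unfolding c_def
  proof (rule measurable_compose_countable[where f="\<lambda>i x. N ((real i + 1) / real (Suc m)) (h x)"
        and g="\<lambda>x. nat \<lfloor>T x * real (Suc m)\<rfloor>"])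
    show "(\<lambda>x. N ((real i + 1) / real (Suc m)) (h x)) \<in> measurable P (count_space UNIV)" for i
      by (rule measurable_compose[OF h N]) simp
    show "(\<lambda>x. nat \<lfloor>T x * real (Suc m)\<rfloor>) \<in> measurable P (count_space UNIV)"
      using T by measurable
  qed
  have c_gt: "T x < c m x" and c_le: "c m x \<le> T x + 1 / real (Suc m)" if "x \<in> space P" for m x
  proof -
    have nonneg: "0 \<le> T x * real (Suc m)"
      using T_nonneg[OF that] by simp
    then have eq: "real (nat \<lfloor>T x * real (Suc m)\<rfloor>) = of_int \<lfloor>T x * real (Suc m)\<rfloor>"
      by (simp add: of_nat_nat)
    have "T x * real (Suc m) < real (nat \<lfloor>T x * real (Suc m)\<rfloor>) + 1"
      unfolding eq by linarith
    then show "T x < c m x"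
      unfolding c_def by (simp add: pos_less_divide_eq del: of_nat_Suc)
    have "real (nat \<lfloor>T x * real (Suc m)\<rfloor>) + 1 \<le> T x * real (Suc m) + 1"
      unfolding eq by linarith
    also have "\<dots> = (T x + 1 / real (Suc m)) * real (Suc m)"
      by (simp add: field_simps)
    finally show "c m x \<le> T x + 1 / real (Suc m)"
      unfolding c_def by (simp add: pos_divide_le_eq del: of_nat_Suc)
  qed
  have "(\<lambda>m. real (N (c m x) (h x))) \<longlonglongrightarrow> real (N (T x) (h x))" if x: "x \<in> space P" for x
  proof -
    have "(\<lambda>m. c m x) \<longlonglongrightarrow> T x"
    proof (rule tendsto_sandwich)
      show "\<forall>\<^sub>F m in sequentially. T x \<le> c m x"
        using c_gt[OF x] by (intro always_eventually allI less_imp_le)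
      show "\<forall>\<^sub>F m in sequentially. c m x \<le> T x + 1 / real (Suc m)"
        using c_le[OF x] by (intro always_eventually allI)
      show "(\<lambda>m. T x + 1 / real (Suc m)) \<longlonglongrightarrow> T x"
        using tendsto_add[OF tendsto_const LIMSEQ_Suc[OF lim_1_over_n]] by simp
    qed simp
    then have lim: "filterlim (\<lambda>m. c m x) (at_right (T x)) sequentially"
      using c_gt[OF x] by (simp add: filterlim_at less_imp_neq[THEN not_sym])
    have "((\<lambda>u. real (N u (h x))) \<longlongrightarrow> real (N (T x) (h x))) (at_right (T x))"
      using rc[OF measurable_space[OF h x] T_nonneg[OF x]] by (simp add: continuous_within)
    from filterlim_compose[OF this lim] show ?thesis .
  qed
  moreover have "(\<lambda>x. real (N (c m x) (h x))) \<in> borel_measurable P" for m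
    using c_meas[of m] by measurable
  ultimately have "(\<lambda>x. real (N (T x) (h x))) \<in> borel_measurable P"
    by (rule borel_measurable_LIMSEQ_real)
  then have "(\<lambda>x. nat \<lfloor>real (N (T x) (h x))\<rfloor>) \<in> measurable P (count_space UNIV)"
    by measurable
  then show ?thesis
    by simp
qed

text \<open>Independence makes the image of \<open>M\<close> under the diagonal map, with one of the
  two sub-sigma-algebras on each factor, a product measure; Tonelli then integrates over the second
  argument while the first one is held fixed.\<close>

lemma (in prob_space) nn_integral_freeze:
  assumes indep: "indep_set \<A> \<B>" and A: "sigma_algebra (space M) \<A>" and B: "sigma_algebra (space M) \<B>"
    and f: "(\<lambda>(w, w'). f w w') \<in> borel_measurable (sigma (space M) \<A> \<Otimes>\<^sub>M sigma (space M) \<B>)"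
  shows "(\<integral>\<^sup>+w. f w w \<partial>M) = (\<integral>\<^sup>+w. (\<integral>\<^sup>+w'. f w w' \<partial>M) \<partial>M)"
proof -
  let ?MA = "sigma (space M) \<A>" and ?MB = "sigma (space M) \<B>"
  have sets: "sets ?MA = \<A>" "sets ?MB = \<B>"
    using A B by (simp_all add: sigma_algebra.sets_measure_of_eq)
  have ev: "\<A> \<subseteq> events" "\<B> \<subseteq> events"
    using indep_setD_ev1[OF indep] indep_setD_ev2[OF indep] by auto
  have spc: "space ?MA = space M" "space ?MB = space M"
    using A B by (simp_all add: space_measure_of_conv)
  have idA: "(\<lambda>w. w) \<in> measurable M ?MA" and idB: "(\<lambda>w. w) \<in> measurable M ?MB"
    using ev sets.sets_into_space by (auto simp: measurable_def sets spc)
  have preim: "{(\<lambda>w. w) -` X \<inter> space M |X. X \<in> \<C>} = \<C>" if "sigma_algebra (space M) \<C>" for \<C>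
  proof -
    interpret C: sigma_algebra "space M" \<C> by fact
    have "(\<lambda>w. w) -` X \<inter> space M = X" if "X \<in> \<C>" for X
      using C.sets_into_space[OF that] by auto
    then show "{(\<lambda>w. w) -` X \<inter> space M |X. X \<in> \<C>} = \<C>"
      by (auto simp del: vimage_ident)
  qed
  have "indep_var ?MA (\<lambda>w. w) ?MB (\<lambda>w. w)"
    unfolding indep_var_eq sets preim[OF A] preim[OF B]
      sigma_algebra.sigma_sets_eq[OF A] sigma_algebra.sigma_sets_eq[OF B]
    using idA idB indep by simp
  then have prod: "distr M ?MA (\<lambda>w. w) \<Otimes>\<^sub>M distr M ?MB (\<lambda>w. w) = distr M (?MA \<Otimes>\<^sub>M ?MB) (\<lambda>w. (w, w))"
    by (simp add: indep_var_distribution_eq)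
  interpret DB: prob_space "distr M ?MB (\<lambda>w. w)"
    by (rule prob_space_distr[OF idB])
  have "(\<integral>\<^sup>+w. f w w \<partial>M) = (\<integral>\<^sup>+x. (\<lambda>(w, w'). f w w') x \<partial>distr M (?MA \<Otimes>\<^sub>M ?MB) (\<lambda>w. (w, w)))"
    using f idA idB by (subst nn_integral_distr) auto
  also have "\<dots> = (\<integral>\<^sup>+w. \<integral>\<^sup>+w'. f w w' \<partial>distr M ?MB (\<lambda>w. w) \<partial>distr M ?MA (\<lambda>w. w))"
    unfolding prod[symmetric] using f
    by (subst DB.nn_integral_fst[symmetric]) (auto cong: measurable_cong_sets)
  also have "\<dots> = (\<integral>\<^sup>+w. (\<integral>\<^sup>+w'. f w w' \<partial>distr M ?MB (\<lambda>w. w)) \<partial>M)"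
  proof (rule nn_integral_distr[OF idA])
    have "(\<lambda>(w, w'). f w w') \<in> borel_measurable (?MA \<Otimes>\<^sub>M distr M ?MB (\<lambda>w. w))"
      using f by (simp cong: measurable_cong_sets sets_pair_measure_cong)
    from DB.borel_measurable_nn_integral[OF this]
    show "(\<lambda>w. \<integral>\<^sup>+w'. f w w' \<partial>distr M ?MB (\<lambda>w. w)) \<in> borel_measurable (distr M ?MA (\<lambda>w. w))"
      by simp
  qed
  also have "\<dots> = (\<integral>\<^sup>+w. (\<integral>\<^sup>+w'. f w w' \<partial>M) \<partial>M)"
  proof (rule nn_integral_cong, rule nn_integral_distr[OF idB])
    fix w assume "w \<in> space M"
    then show "(\<lambda>w'. f w w') \<in> borel_measurable (distr M ?MB (\<lambda>w. w))"
      using measurable_compose[OF measurable_Pair1' f, of w] spc by simp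
  qed
  finally show ?thesis .
qed

text \<open>The measure is arbitrary because the decomposition is later applied to the auxiliary
  measure \<open>\<nu>\<close>, under which the law of \<open>H\<close> need not be known.\<close>

lemma emeasure_split_countable:
  fixes H :: "'a \<Rightarrow> 'b :: countable"
  assumes H: "H \<in> measurable M (count_space UNIV)" and A: "A \<in> sets M"
  shows "emeasure M A = (\<integral>\<^sup>+i. emeasure M (A \<inter> {x\<in>space M. H x = i}) \<partial>count_space UNIV)"
proof -
  have "A = (\<Union>i. A \<inter> {x\<in>space M. H x = i})"
    using sets.sets_into_space[OF A] by auto
  then have "emeasure M A = emeasure M (\<Union>i. A \<inter> {x\<in>space M. H x = i})"
    by simp
  also have "\<dots> = (\<integral>\<^sup>+i. emeasure M (A \<inter> {x\<in>space M. H x = i}) \<partial>count_space UNIV)"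
  proof (rule emeasure_UN_countable)
    show "A \<inter> {x\<in>space M. H x = i} \<in> sets M" if "i \<in> UNIV" for i
      using A H by measurable
  qed (auto simp: disjoint_family_on_def)
  finally show ?thesis .
qed

section \<open>Generating functions of the Poisson and binomial laws\<close>

text \<open>The formula also makes sense for \<open>a = 0\<close>, where it is the point mass at 0.
  This rate occurs in steps that take no time, such as a selection or a service of length
  zero.\<close>

definition poisson_mass :: "real \<Rightarrow> nat \<Rightarrow> real" where
  "poisson_mass a n = a ^ n / fact n * exp (- a)"

lemma poisson_mass_nonneg: "0 \<le> a \<Longrightarrow> 0 \<le> poisson_mass a n"
  by (simp add: poisson_mass_def)

lemma poisson_mass_0: "poisson_mass 0 n = (if n = 0 then 1 else 0)"
  by (simp add: poisson_mass_def)

lemma pmf_poisson_mass: "0 < a \<Longrightarrow> pmf (poisson_pmf a) n = poisson_mass a n"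
  by (simp add: poisson_mass_def)

lemma nn_integral_poisson_mass:
  assumes "0 \<le> a" "0 \<le> y"
  shows "(\<integral>\<^sup>+n. ennreal (poisson_mass a n * y ^ n) \<partial>count_space UNIV) = ennreal (exp (a * (y - 1)))"
proof -
  have "(\<lambda>n. (a * y) ^ n /\<^sub>R fact n) sums exp (a * y)"
    by (rule exp_converges)
  from sums_mult2[OF this, of "exp (- a)"]
  have sums: "(\<lambda>n. poisson_mass a n * y ^ n) sums exp (a * (y - 1))"
    by (simp add: poisson_mass_def power_mult_distrib divide_inverse mult_ac exp_add[symmetric] algebra_simps)
  have "(\<integral>\<^sup>+n. ennreal (poisson_mass a n * y ^ n) \<partial>count_space UNIV) = (\<Sum>n. ennreal (poisson_mass a n * y ^ n))"
    by (rule nn_integral_count_space_nat)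
  also have "\<dots> = ennreal (exp (a * (y - 1)))"
    using assms by (intro suminf_ennreal_eq sums) (simp add: poisson_mass_nonneg)
  finally show ?thesis .
qed

lemma nn_integral_prod_poisson_mass:
  fixes a y :: "'k :: finite \<Rightarrow> real"
  assumes a: "\<And>k. 0 \<le> a k" and y: "\<And>k. 0 \<le> y k"
  shows "(\<integral>\<^sup>+d. ennreal (\<Prod>k\<in>UNIV. poisson_mass (a k) (d k) * y k ^ d k) \<partial>count_space UNIV) =
    ennreal (exp (\<Sum>k\<in>UNIV. a k * (y k - 1)))"
proof -
  \<comment> \<open>\<open>P k\<close> is the law with masses \<open>poisson_mass (a k)\<close>, the
    rate 0 being split off as a point mass. Under the product of these laws, the integral of a
    product of functions of single coordinates factorizes.\<close>
  define P where "P k = (if a k = 0 then return_pmf 0 else poisson_pmf (a k))" for k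
  have pmf_P: "pmf (P k) n = poisson_mass (a k) n" for k n
  proof (cases "a k = 0")
    case False
    then have "0 < a k"
      using a[of k] by simp
    then show ?thesis
      by (simp add: P_def pmf_poisson_mass del: pmf_poisson)
  qed (simp add: P_def poisson_mass_0)
  have "ennreal (\<Prod>k\<in>UNIV. poisson_mass (a k) (d k) * y k ^ d k) =
      ennreal (pmf (Pi_pmf UNIV 0 P) d) * (\<Prod>k\<in>UNIV. ennreal (y k ^ d k))" for d
  proof -
    have "(\<Prod>k\<in>UNIV. poisson_mass (a k) (d k) * y k ^ d k) = pmf (Pi_pmf UNIV 0 P) d * (\<Prod>k\<in>UNIV. y k ^ d k)"
      by (simp only: prod.distrib pmf_Pi[OF finite] pmf_P UNIV_I not_True_eq_False simp_thms if_True)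
    moreover have "(\<Prod>k\<in>UNIV. ennreal (y k ^ d k)) = ennreal (\<Prod>k\<in>UNIV. y k ^ d k)"
      using y by (intro prod_ennreal) simp
    ultimately show ?thesis
      using y by (simp only: ennreal_mult'[OF pmf_nonneg])
  qed
  then have "(\<integral>\<^sup>+d. ennreal (\<Prod>k\<in>UNIV. poisson_mass (a k) (d k) * y k ^ d k) \<partial>count_space UNIV) =
    (\<integral>\<^sup>+d. ennreal (pmf (Pi_pmf UNIV 0 P) d) * (\<Prod>k\<in>UNIV. ennreal (y k ^ d k)) \<partial>count_space UNIV)"
    by simp
  also have "\<dots> = (\<integral>\<^sup>+d. (\<Prod>k\<in>UNIV. ennreal (y k ^ d k)) \<partial>measure_pmf (Pi_pmf UNIV 0 P))"
    by (simp add: nn_integral_measure_pmf)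
  also have "\<dots> = (\<Prod>k\<in>UNIV. \<integral>\<^sup>+n. ennreal (y k ^ n) \<partial>measure_pmf (P k))"
    by (rule nn_integral_prod_Pi_pmf) simp
  also have "\<dots> = (\<Prod>k\<in>UNIV. ennreal (exp (a k * (y k - 1))))"
    using a y
    by (simp add: nn_integral_measure_pmf pmf_P ennreal_mult'[symmetric] poisson_mass_nonneg nn_integral_poisson_mass)
  also have "\<dots> = ennreal (exp (\<Sum>k\<in>UNIV. a k * (y k - 1)))"
    by (simp add: prod_ennreal exp_sum)
  finally show ?thesis .
qed

text \<open>The binomial theorem: each of the \<open>x\<close> customers contributes the factor
  \<open>v\<close> with probability \<open>r\<close> and the factor \<open>u\<close>
  otherwise.\<close>

lemma nn_integral_binomial_pmf_power:
  assumes r: "r \<in> {0..1}" and "0 \<le> u" "0 \<le> v"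
  shows "(\<integral>\<^sup>+y. ennreal (u ^ (x - y) * v ^ y) \<partial>measure_pmf (binomial_pmf x r)) = ennreal (((1 - r) * u + r * v) ^ x)"
proof -
  have "finite (set_pmf (binomial_pmf x r))"
    using r by (rule finite_set_pmf_binomial_pmf)
  then have "(\<integral>\<^sup>+y. ennreal (u ^ (x - y) * v ^ y) \<partial>measure_pmf (binomial_pmf x r)) =
      ennreal (measure_pmf.expectation (binomial_pmf x r) (\<lambda>y. u ^ (x - y) * v ^ y))"
    using assms by (intro nn_integral_eq_integral integrable_measure_pmf_finite) auto
  also have "measure_pmf.expectation (binomial_pmf x r) (\<lambda>y. u ^ (x - y) * v ^ y) = (r * v + (1 - r) * u) ^ x"
    using r unfolding binomial_ring
    by (subst expectation_binomial_pmf') (auto simp: power_mult_distrib mult_ac intro!: sum.cong)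
  finally show ?thesis
    by (simp add: add.commute)
qed

lemma measurable_sigma_mono:
  assumes "sigma_algebra \<Omega> \<C>" "sigma_algebra \<Omega> \<D>" "\<C> \<subseteq> \<D>" "X \<in> measurable (sigma \<Omega> \<C>) R"
  shows "X \<in> measurable (sigma \<Omega> \<D>) R"
  using assms
  by (auto simp: measurable_def space_measure_of_conv sigma_algebra.sets_measure_of_eq)

lemma prod_list_index:
  assumes "distinct xs"
  shows "(\<Prod>i<length xs. g (xs ! i)) = (\<Prod>x\<in>set xs. g x)"
  by (rule prod.reindex_bij_betw[OF bij_betw_nth[OF assms refl refl]])

lemma measurable_count_space_fun:
  fixes H :: "'a \<Rightarrow> 'k :: finite \<Rightarrow> 'b :: countable"
  assumes [measurable]: "\<And>k. (\<lambda>w. H w k) \<in> measurable M (count_space UNIV)"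
  shows "H \<in> measurable M (count_space UNIV)"
proof (subst measurable_count_space_eq2_countable, intro conjI ballI)
  fix a :: "'k \<Rightarrow> 'b"
  have "H -` {a} \<inter> space M = {w\<in>space M. \<forall>k\<in>UNIV. H w k = a k}"
    by (auto simp: fun_eq_iff)
  also have "\<dots> \<in> sets M"
    by measurable
  finally show "H -` {a} \<inter> space M \<in> sets M" .
qed auto

section \<open>Product weights and exponential estimates\<close>

definition weight :: "('k :: finite \<Rightarrow> real) \<Rightarrow> ('k \<Rightarrow> nat) \<Rightarrow> real" where
  "weight u q = (\<Prod>k\<in>UNIV. u k ^ q k)"

lemma weight_nonneg: "(\<And>k. 0 \<le> u k) \<Longrightarrow> 0 \<le> weight u q"
  by (simp add: weight_def prod_nonneg)

lemma weight_mono: "(\<And>k. 0 \<le> u k) \<Longrightarrow> (\<And>k. u k \<le> v k) \<Longrightarrow> weight u q \<le> weight v q"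
  unfolding weight_def by (intro prod_mono conjI power_mono) auto

lemma weight_add: "weight u (\<lambda>k. q k + d k) = weight u q * weight u d"
  by (simp add: weight_def power_add prod.distrib)

lemma weight_remove: "weight u q = u k ^ q k * weight u (q(k := 0))"
  unfolding weight_def by (subst (1 2) prod.remove[of UNIV k]) auto

lemma weight_update: "weight u (q(k := n)) = u k ^ n * weight u (q(k := 0))"
  by (subst weight_remove[of _ _ k]) simp

lemma weight_upd_base: "weight (u(k := v)) q = v ^ q k * weight u (q(k := 0))"
proof -
  have "weight (u(k := v)) (q(k := 0)) = weight u (q(k := 0))"
    unfolding weight_def by (intro prod.cong) auto
  then show ?thesis
    by (subst weight_remove[of _ _ k]) simp
qed

text \<open>A second-order bound on the whole half-line: up to 1 it follows from the Taylor bound,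
  beyond 1 the last term alone dominates.\<close>

lemma exp_le_quadratic:
  assumes "0 \<le> (u :: real)"
  shows "exp u \<le> 1 + u + u\<^sup>2 * exp u"
proof (cases "u \<le> 1")
  case True
  have "u\<^sup>2 * 1 \<le> u\<^sup>2 * exp u"
    using assms by (intro mult_left_mono) auto
  then show ?thesis
    using exp_bound[OF assms True] by simp
next
  case False
  then have "1 * exp u \<le> u\<^sup>2 * exp u"
    by (intro mult_right_mono) auto
  then show ?thesis
    using assms by linarith
qed

text \<open>Second-order expansion of the moment generating function at 0. The remainder contains
  x^2 exp (t x); keeping \<open>t\<close> below \<open>\<delta> / 2\<close> leaves half of the
  exponent \<open>\<delta> * x\<close> to absorb x^2.\<close>

lemma nonneg_law_mgf_bound:
  assumes law: "nonneg_law L m" and \<delta>: "0 < \<delta>" and mgf: "integrable L (\<lambda>x. exp (\<delta> * x))"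
  obtains B where "0 \<le> B"
    and "\<And>t. 0 \<le> t \<Longrightarrow> t \<le> \<delta> / 2 \<Longrightarrow> (\<integral>\<^sup>+x. ennreal (exp (t * x)) \<partial>L) \<le> ennreal (1 + t * m + B * t\<^sup>2)"
proof
  interpret prob_space L
    using law by (simp add: nonneg_law_def)
  have sets: "sets L = sets borel" and nonneg: "AE x in L. 0 \<le> x"
    and int: "integrable L (\<lambda>x. x)" and mean: "(\<integral>x. x \<partial>L) = m"
    using law by (auto simp: nonneg_law_def)
  let ?B = "8 / \<delta>\<^sup>2 * (\<integral>x. exp (\<delta> * x) \<partial>L)"
  show "0 \<le> ?B"
    by simp
  fix t assume t: "0 \<le> t" "t \<le> \<delta> / 2"
  let ?g = "\<lambda>x. 1 + t * x + t\<^sup>2 * (8 / \<delta>\<^sup>2 * exp (\<delta> * x))"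
  have bound: "exp (t * x) \<le> ?g x" if x: "0 \<le> x" for x
  proof -
    \<comment> \<open>From exp y >= y^2 / 2 at y = \<open>\<delta> * x / 2\<close>; this is the
      origin of the 8 in \<open>?B\<close>.\<close>
    have "(\<delta> * x / 2)\<^sup>2 / 2 \<le> exp (\<delta> * x / 2)"
    proof -
      have "0 \<le> \<delta> * x / 2"
        using \<delta> x by simp
      then show ?thesis
        using exp_lower_Taylor_quadratic[of "\<delta> * x / 2"] by linarith
    qed
    then have sq: "x\<^sup>2 \<le> 8 / \<delta>\<^sup>2 * exp (\<delta> * x / 2)"
      using \<delta> by (simp add: field_simps power2_eq_square)
    have "x\<^sup>2 * exp (t * x) \<le> 8 / \<delta>\<^sup>2 * exp (\<delta> * x / 2) * exp (\<delta> * x / 2)"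
    proof (rule mult_mono[OF sq])
      have "t * x \<le> \<delta> / 2 * x"
        using t x by (intro mult_right_mono) auto
      then show "exp (t * x) \<le> exp (\<delta> * x / 2)"
        by simp
    qed auto
    also have "\<dots> = 8 / \<delta>\<^sup>2 * exp (\<delta> * x)"
      by (simp add: mult_exp_exp)
    finally have "t\<^sup>2 * (x\<^sup>2 * exp (t * x)) \<le> t\<^sup>2 * (8 / \<delta>\<^sup>2 * exp (\<delta> * x))"
      by (intro mult_left_mono) auto
    then show ?thesis
      using exp_le_quadratic[of "t * x"] t x by (simp add: power_mult_distrib mult.assoc)
  qed
  have int_g: "integrable L ?g"
    using int mgf by (intro Bochner_Integration.integrable_add integrable_mult_right integrable_const) auto
  have g_nonneg: "AE x in L. 0 \<le> ?g x"
    using nonneg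
  proof eventually_elim
    case (elim x)
    then show ?case
      using order_trans[OF _ bound[OF elim], of 0] by simp
  qed
  have "(\<integral>\<^sup>+x. ennreal (exp (t * x)) \<partial>L) \<le> (\<integral>\<^sup>+x. ennreal (?g x) \<partial>L)"
  proof (rule nn_integral_mono_AE)
    show "AE x in L. ennreal (exp (t * x)) \<le> ennreal (?g x)"
      using nonneg by eventually_elim (rule ennreal_leI[OF bound])
  qed
  also have "\<dots> = ennreal (\<integral>x. ?g x \<partial>L)"
    by (rule nn_integral_eq_integral[OF int_g g_nonneg])
  also have "(\<integral>x. ?g x \<partial>L) = (\<integral>x. 1 + t * x \<partial>L) + (\<integral>x. t\<^sup>2 * (8 / \<delta>\<^sup>2 * exp (\<delta> * x)) \<partial>L)"
    using int mgf by (intro Bochner_Integration.integral_add) auto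
  also have "(\<integral>x. 1 + t * x \<partial>L) = (\<integral>x. 1 \<partial>L) + (\<integral>x. t * x \<partial>L)"
    using int by (intro Bochner_Integration.integral_add) auto
  finally show "(\<integral>\<^sup>+x. ennreal (exp (t * x)) \<partial>L) \<le> ennreal (1 + t * m + ?B * t\<^sup>2)"
    by (simp add: mean prob_space mult_ac)
qed

text \<open>The term of order \<open>l\<close> in the exponential series at \<open>ln b * n\<close>
  is at most the whole sum \<open>b ^ n\<close>.\<close>

lemma power_le_exponential:
  assumes "1 < (b :: real)"
  obtains c where "0 \<le> c" "\<And>n. real n ^ l \<le> c * b ^ n"
proof
  let ?a = "ln b"
  have a: "0 < ?a"
    using assms by simp
  show "0 \<le> fact l / ?a ^ l"
    using a by simp
  fix n
  let ?y = "?a * real n"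
  have y: "0 \<le> ?y"
    using a by simp
  have "(\<Sum>i\<in>{l}. ?y ^ i /\<^sub>R fact i) \<le> exp ?y"
    unfolding exp_def using y by (intro sum_le_suminf summable_exp_generic) auto
  then have "?y ^ l / fact l \<le> exp ?y"
    by (simp add: divide_inverse mult.commute)
  then have "?a ^ l * real n ^ l \<le> fact l * exp ?y"
    by (simp add: pos_divide_le_eq power_mult_distrib mult.commute)
  also have "exp ?y = b ^ n"
    using assms by (simp add: exp_of_nat2_mult exp_ln)
  finally show "real n ^ l \<le> fact l / ?a ^ l * b ^ n"
    using a by (simp add: field_simps)
qed

section \<open>Traces\<close>

context bep_polling
begin

definition source_sets :: "'k source \<Rightarrow> 'w set set" where
  "source_sets src = (case src of
            Initial \<Rightarrow> sigma_sets (space M) {X0 -` A \<inter> space M | A. A \<in> UNIV}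
          | Arrivals k \<Rightarrow> sigma_sets (space M) {N k t -` A \<inter> space M | t A. 0 \<le> t}
          | Service_time n j \<Rightarrow> sigma_sets (space M) {S n j -` A \<inter> space M | A. A \<in> sets borel}
          | Switchover n \<Rightarrow> sigma_sets (space M) {V n -` A \<inter> space M | A. A \<in> sets borel}
          | Selection n \<Rightarrow> sigma_sets (space M) {Y n x -` A \<inter> space M | x A. A \<in> UNIV})"

lemma indep_source_sets: "indep_sets source_sets UNIV"
  using independence unfolding source_sets_def .

lemma sigma_algebra_source_sets: "sigma_algebra (space M) (source_sets src)"
  unfolding source_sets_def
  by (cases src) (auto intro!: sigma_algebra_sigma_sets)

lemma source_sets_events: "source_sets src \<subseteq> events"
  using indep_source_sets by (auto simp: indep_sets_def)

lemma arrivals_process: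
  shows N_measurable: "0 \<le> t \<Longrightarrow> N k t \<in> measurable M (count_space UNIV)"
    and N_mono: "w \<in> space M \<Longrightarrow> 0 \<le> a \<Longrightarrow> a \<le> t \<Longrightarrow> N k a w \<le> N k t w"
    and N_right_continuous: "w \<in> space M \<Longrightarrow> 0 \<le> t \<Longrightarrow> continuous (at_right t) (\<lambda>u. real (N k u w))"
    and N_increment: "0 \<le> a \<Longrightarrow> a < t \<Longrightarrow> distr M (count_space UNIV) (\<lambda>w. N k t w - N k a w) =
      measure_pmf (poisson_pmf (lam k * (t - a)))"
    and N_independent: "0 \<le> (ts :: nat \<Rightarrow> real) 0 \<Longrightarrow> mono ts \<Longrightarrow>
      indep_vars (\<lambda>_. count_space UNIV) (\<lambda>j w. N k (ts (Suc j)) w - N k (ts j) w) UNIV"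
  using arrivals[of k, unfolded poisson_process_def] by simp_all

definition duration :: "'k source \<Rightarrow> 'w \<Rightarrow> real" where
  "duration src w = (case src of Service_time n j \<Rightarrow> S n j w | Switchover n \<Rightarrow> V n w | _ \<Rightarrow> 0)"

lemma duration_simps [simp]:
  "duration (Service_time n j) = S n j"
  "duration (Switchover n) = V n"
  "duration (Selection n) = (\<lambda>_. 0)"
  "duration Initial = (\<lambda>_. 0)"
  "duration (Arrivals k) = (\<lambda>_. 0)"
  by (auto simp: duration_def fun_eq_iff)

lemma duration_nonneg: "w \<in> space M \<Longrightarrow> 0 \<le> duration src w"
  by (auto simp: duration_def S_nonneg V_nonneg split: source.split)

text \<open>Measurability with respect to the sigma-algebra of the source itself, and not just
  \<open>M\<close>, is what makes functions of different durations independent.\<close>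

lemma duration_measurable_source: "duration src \<in> borel_measurable (sigma (space M) (source_sets src))"
proof -
  have "duration src -` A \<inter> space M \<in> source_sets src" if A: "A \<in> sets borel" for A
  proof -
    interpret C: sigma_algebra "space M" "source_sets src"
      by (rule sigma_algebra_source_sets)
    have const: "(\<lambda>_. 0 :: real) -` A \<inter> space M \<in> source_sets src"
      by (cases "(0 :: real) \<in> A") auto
    show ?thesis
    proof (cases src)
      case (Service_time n j)
      have "S n j -` A \<inter> space M \<in> {S n j -` A \<inter> space M | A. A \<in> sets borel}"
        using A by auto
      then show ?thesis
        unfolding Service_time by (simp add: source_sets_def sigma_sets.Basic)
    next
      case (Switchover n)
      have "V n -` A \<inter> space M \<in> {V n -` A \<inter> space M | A. A \<in> sets borel}"
        using A by auto
      then show ?thesis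
        unfolding Switchover by (simp add: source_sets_def sigma_sets.Basic)
    qed (use const in \<open>simp_all\<close>)
  qed
  then show ?thesis
    by (simp add: measurable_def space_measure_of_conv
        sigma_algebra.sets_measure_of_eq[OF sigma_algebra_source_sets])
qed

lemma measurable_from_source:
  assumes "X \<in> measurable (sigma (space M) (source_sets src)) R"
  shows "X \<in> measurable M R"
  using assms source_sets_events
  by (auto simp: measurable_def space_measure_of_conv sigma_algebra.sets_measure_of_eq[OF sigma_algebra_source_sets])

lemma duration_measurable [measurable]: "duration src \<in> borel_measurable M"
  by (rule measurable_from_source[OF duration_measurable_source])

lemma N_at_random_time:
  assumes "T \<in> borel_measurable M" "\<And>w. w \<in> space M \<Longrightarrow> 0 \<le> T w"
  shows "(\<lambda>w. N k (T w) w) \<in> measurable M (count_space UNIV)"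
  by (rule measurable_at_random_time[OF N_measurable N_right_continuous assms measurable_ident_sets[OF refl]])

lemma prob_increments:
  assumes mono: "mono ts" and ts0: "0 \<le> (ts 0 :: real)"
  shows "prob {w\<in>space M. \<forall>i<L. \<forall>k. N k (ts (Suc i)) w - N k (ts i) w = d i k} =
    (\<Prod>i<L. \<Prod>k\<in>UNIV. poisson_mass (lam k * (ts (Suc i) - ts i)) (d i k))"
proof -
  define D where "D k i w = N k (ts (Suc i)) w - N k (ts i) w" for k i w
  define E where "E k = {w\<in>space M. \<forall>i<L. D k i w = d i k}" for k
  have ts: "0 \<le> ts i" for i
    using ts0 monoD[OF mono, of 0 i] by simp
  have single: "prob (D k i -` {n} \<inter> space M) = poisson_mass (lam k * (ts (Suc i) - ts i)) n" for k i n
  proof (cases "ts (Suc i) = ts i")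
    case True
    then have "D k i -` {n} \<inter> space M = (if n = 0 then space M else {})"
      by (auto simp: D_def)
    then show ?thesis
      using True by (simp add: poisson_mass_0 prob_space)
  next
    case False
    then have less: "ts i < ts (Suc i)"
      using monoD[OF mono, of i "Suc i"] by simp
    have "prob (D k i -` {n} \<inter> space M) = measure (distr M (count_space UNIV) (D k i)) {n}"
      using ts N_measurable by (subst measure_distr) (auto simp: D_def[abs_def])
    also have "\<dots> = pmf (poisson_pmf (lam k * (ts (Suc i) - ts i))) n"
      unfolding D_def[abs_def] N_increment[OF ts less] by (simp add: measure_pmf_single)
    also have "\<dots> = poisson_mass (lam k * (ts (Suc i) - ts i)) n"
      using lam_pos[of k] less by (intro pmf_poisson_mass) simp
    finally show ?thesis .
  qed
  have E_eq: "E k = (\<Inter>i<L. D k i -` {d i k} \<inter> space M)" if "0 < L" for k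
    using that by (auto simp: E_def)
  have prob_E: "prob (E k) = (\<Prod>i<L. poisson_mass (lam k * (ts (Suc i) - ts i)) (d i k))" for k
  \<comment> \<open>An intersection over no indices would be the universe instead of
    \<open>space M\<close>.\<close>
  proof (cases "L = 0")
    case True
    then show ?thesis
      by (simp add: E_def prob_space)
  next
    case False
    have "prob (\<Inter>i<L. D k i -` {d i k} \<inter> space M) = (\<Prod>i<L. prob (D k i -` {d i k} \<inter> space M))"
      using N_independent[OF ts0 mono, of k] False
      by (intro indep_varsD[where I=UNIV and M'="\<lambda>_. count_space UNIV"]) (auto simp: D_def[abs_def])
    then show ?thesis
      using False by (simp add: E_eq single)
  qed
  have E_source: "E k \<in> source_sets (Arrivals k)" for k
  proof -
    let ?C = "source_sets (Arrivals k)"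
    have N_C: "N k t \<in> measurable (sigma (space M) ?C) (count_space UNIV)" if "0 \<le> t" for t
      using that
      by (auto simp: measurable_def space_measure_of_conv sigma_algebra.sets_measure_of_eq[OF sigma_algebra_source_sets])
         (auto simp: source_sets_def intro!: sigma_sets.Basic)
    have [measurable]: "N k (ts i) \<in> measurable (sigma (space M) ?C) (count_space UNIV)" for i
      by (rule N_C[OF ts])
    have "{w\<in>space (sigma (space M) ?C). \<forall>i\<in>{..<L}. D k i w = d i k} \<in> sets (sigma (space M) ?C)"
      unfolding D_def by measurable
    then show ?thesis
      by (simp add: E_def Ball_def space_measure_of_conv sigma_algebra.sets_measure_of_eq[OF sigma_algebra_source_sets])
  qed
  define E' where "E' src = (case src of Arrivals k \<Rightarrow> E k | _ \<Rightarrow> {})" for src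
  have inj: "inj (Arrivals :: 'k \<Rightarrow> 'k source)"
    by (auto simp: inj_def)
  have "{w\<in>space M. \<forall>i<L. \<forall>k. N k (ts (Suc i)) w - N k (ts i) w = d i k} = (\<Inter>src\<in>range Arrivals. E' src)"
    by (auto simp: E'_def E_def D_def)
  also have "prob \<dots> = (\<Prod>src\<in>range Arrivals. prob (E' src))"
    using E_source by (intro indep_setsD[OF indep_source_sets]) (auto simp: E'_def)
  also have "\<dots> = (\<Prod>k\<in>UNIV. prob (E k))"
    using inj by (simp add: prod.reindex E'_def)
  also have "\<dots> = (\<Prod>i<L. \<Prod>k\<in>UNIV. poisson_mass (lam k * (ts (Suc i) - ts i)) (d i k))"
    unfolding prob_E by (rule prod.swap)
  finally show ?thesis .
qed

section \<open>Traces and their probabilities\<close>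

definition clock :: "'k source list \<Rightarrow> nat \<Rightarrow> 'w \<Rightarrow> real" where
  "clock ss i w = (\<Sum>j<i. duration (ss ! j) w)"

text \<open>
  The initial state and the selections also appear as steps of a trace; they take no time, and the
  set \<open>B src\<close> prescribes their outcome.
\<close>

definition trace :: "'k source list \<Rightarrow> ('k source \<Rightarrow> 'w set) \<Rightarrow> ('k source \<Rightarrow> 'k \<Rightarrow> nat) \<Rightarrow> 'w set" where
  "trace ss B d = {w\<in>space M. \<forall>i<length ss. w \<in> B (ss ! i) \<and>
     (\<forall>k. N k (clock ss (Suc i) w) w - N k (clock ss i w) w = d (ss ! i) k)}"

text \<open>Joint probability of the outcome \<open>B\<close> and of \<open>d\<close> arrivals
  during the step, obtained by conditioning on the duration of the step.\<close>

definition step_mass :: "'k source \<Rightarrow> 'w set \<Rightarrow> ('k \<Rightarrow> nat) \<Rightarrow> ennreal" where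
  "step_mass src B d =
     (\<integral>\<^sup>+w. indicator B w * ennreal (\<Prod>k\<in>UNIV. poisson_mass (lam k * duration src w) (d k)) \<partial>M)"

lemma clock_nonneg: "w \<in> space M \<Longrightarrow> 0 \<le> clock ss i w"
  by (auto simp: clock_def intro!: sum_nonneg duration_nonneg)

lemma clock_measurable [measurable]: "clock ss i \<in> borel_measurable M"
  unfolding clock_def[abs_def] by measurable

lemma clock_mono: "w \<in> space M \<Longrightarrow> mono (\<lambda>i. clock ss i w)"
  unfolding incseq_Suc_iff by (simp add: clock_def duration_nonneg)

lemma trace_events:
  assumes "\<And>src. src \<in> set ss \<Longrightarrow> B src \<in> events"
  shows "trace ss B d \<in> events"
proof -
  have [measurable]: "(\<lambda>w. N k (clock ss i w) w) \<in> measurable M (count_space UNIV)" for k i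
    by (rule N_at_random_time) (auto simp: clock_nonneg)
  have [measurable]: "B (ss ! i) \<in> events" if "i < length ss" for i
    using assms that by simp
  have "trace ss B d = {w\<in>space M. \<forall>i\<in>{..<length ss}. w \<in> B (ss ! i) \<and>
     (\<forall>k\<in>UNIV. N k (clock ss (Suc i) w) w - N k (clock ss i w) w = d (ss ! i) k)}"
    by (auto simp: trace_def)
  also have "\<dots> \<in> events"
    by measurable
  finally show ?thesis .
qed

text \<open>Outcomes and durations are independent of all arrival processes, so they can be frozen.
  The step boundaries are then deterministic, and the arrival counts have a product law. What
  remains is the expectation of a product of functions of distinct, hence independent,
  sources.\<close>

lemma emeasure_trace:
  assumes distinct: "distinct ss" and not_arrivals: "\<And>src. src \<in> set ss \<Longrightarrow> src \<notin> range Arrivals"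
    and B: "\<And>src. src \<in> set ss \<Longrightarrow> B src \<in> source_sets src"
  shows "emeasure M (trace ss B d) = (\<Prod>src\<in>set ss. step_mass src (B src) (d src))"
proof -
  let ?L = "length ss"
  \<comment> \<open>Two blocks of sources: \<open>False\<close> for the arrival processes,
    \<open>True\<close> for all others.\<close>
  define G where "G b = (if b then - range Arrivals else range (Arrivals :: 'k \<Rightarrow> 'k source))" for b
  define \<C> where "\<C> b = sigma_sets (space M) (\<Union>src\<in>G b. source_sets src)" for b
  let ?MA = "sigma (space M) (\<C> True)" and ?MB = "sigma (space M) (\<C> False)"
  have "indep_sets \<C> UNIV"
    unfolding \<C>_def
  proof (rule indep_sets_collect_sigma)
    show "indep_sets source_sets (\<Union>b\<in>UNIV. G b)"
      using indep_source_sets by (rule indep_sets_mono_index[rotated]) simp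
    show "Int_stable (source_sets src)" for src
    proof -
      interpret C: sigma_algebra "space M" "source_sets src"
        by (rule sigma_algebra_source_sets)
      show ?thesis
        by (auto simp: Int_stable_def)
    qed
    show "disjoint_family_on G UNIV"
      by (auto simp: disjoint_family_on_def G_def)
  qed
  then have ind: "indep_set (\<C> True) (\<C> False)"
    unfolding indep_set_def by (rule back_subst[where P="\<lambda>F. indep_sets F UNIV"]) (auto simp: fun_eq_iff split: bool.split)
  have sub: "source_sets src \<subseteq> Pow (space M)" for src
    using source_sets_events sets.space_closed by blast
  have sa: "sigma_algebra (space M) (\<C> b)" for b
    unfolding \<C>_def using sub by (intro sigma_algebra_sigma_sets) auto
  have source_sub: "source_sets src \<subseteq> \<C> b" if "src \<in> G b" for src b
    unfolding \<C>_def using that by (auto intro: sigma_sets.Basic)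
  have dur: "duration src \<in> borel_measurable ?MA" if "src \<in> set ss" for src
    using measurable_sigma_mono[OF sigma_algebra_source_sets sa source_sub duration_measurable_source]
      not_arrivals[OF that] by (simp add: G_def)
  have B_A: "B src \<in> sets ?MA" if "src \<in> set ss" for src
    using B[OF that] source_sub[of src True] not_arrivals[OF that]
    by (auto simp: G_def sigma_algebra.sets_measure_of_eq[OF sa])
  have N_B: "N k t \<in> measurable ?MB (count_space UNIV)" if "0 \<le> t" for k t
  proof -
    have "N k t \<in> measurable (sigma (space M) (source_sets (Arrivals k))) (count_space UNIV)"
      using that
      by (auto simp: measurable_def space_measure_of_conv sigma_algebra.sets_measure_of_eq[OF sigma_algebra_source_sets])
         (auto simp: source_sets_def intro!: sigma_sets.Basic)
    then show ?thesis
      by (rule measurable_sigma_mono[OF sigma_algebra_source_sets sa source_sub, rotated]) (simp add: G_def)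
  qed
  have spc: "space ?MA = space M" "space ?MB = space M"
    by (simp_all add: space_measure_of_conv)
  \<comment> \<open>The first argument drives outcomes and clock, the second the arrivals, so that
    \<open>f w w\<close> is the indicator of the trace.\<close>
  define f where "f w w' = (indicator {w\<in>space M. \<forall>i\<in>{..<?L}. w \<in> B (ss ! i)} w *
    indicator {x\<in>space (?MA \<Otimes>\<^sub>M ?MB). \<forall>i\<in>{..<?L}. \<forall>k\<in>UNIV.
      N k (clock ss (Suc i) (fst x)) (snd x) - N k (clock ss i (fst x)) (snd x) = d (ss ! i) k} (w, w') :: ennreal)" for w w'
  have clock_A: "clock ss i \<in> borel_measurable ?MA" if "i \<le> ?L" for i
    unfolding clock_def[abs_def] using that by (intro borel_measurable_sum dur) auto
  have [measurable]: "(\<lambda>x. N k (clock ss i (fst x)) (snd x)) \<in> measurable (?MA \<Otimes>\<^sub>M ?MB) (count_space UNIV)"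
    if "i \<le> ?L" for k i
  proof (rule measurable_at_random_time[where M="?MB"])
    show "(\<lambda>x. clock ss i (fst x)) \<in> borel_measurable (?MA \<Otimes>\<^sub>M ?MB)"
      using clock_A[OF that] by measurable
    show "0 \<le> clock ss i (fst x)" if "x \<in> space (?MA \<Otimes>\<^sub>M ?MB)" for x
      using that by (auto simp: space_pair_measure spc clock_nonneg)
  qed (use N_B N_right_continuous spc in auto)
  have f: "(\<lambda>(w, w'). f w w') \<in> borel_measurable (?MA \<Otimes>\<^sub>M ?MB)"
  proof -
    have [measurable]: "{w\<in>space M. \<forall>i\<in>{..<?L}. w \<in> B (ss ! i)} \<in> sets ?MA"
    proof -
      have [measurable]: "B (ss ! i) \<in> sets ?MA" if "i < ?L" for i
        using B_A that by simp
      have "{w\<in>space ?MA. \<forall>i\<in>{..<?L}. w \<in> B (ss ! i)} \<in> sets ?MA"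
        by measurable
      then show ?thesis
        by (simp add: spc)
    qed
    have [measurable]: "{x\<in>space (?MA \<Otimes>\<^sub>M ?MB). \<forall>i\<in>{..<?L}. \<forall>k\<in>UNIV.
        N k (clock ss (Suc i) (fst x)) (snd x) - N k (clock ss i (fst x)) (snd x) = d (ss ! i) k} \<in> sets (?MA \<Otimes>\<^sub>M ?MB)"
      by measurable
    show ?thesis
      unfolding f_def by measurable
  qed
  have "emeasure M (trace ss B d) = (\<integral>\<^sup>+w. indicator (trace ss B d) w \<partial>M)"
    using B source_sets_events by (intro nn_integral_indicator[symmetric] trace_events) blast
  also have "\<dots> = (\<integral>\<^sup>+w. f w w \<partial>M)"
    by (intro nn_integral_cong) (auto simp: f_def trace_def space_pair_measure spc split: split_indicator)
  also have "\<dots> = (\<integral>\<^sup>+w. (\<integral>\<^sup>+w'. f w w' \<partial>M) \<partial>M)"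
    by (rule nn_integral_freeze[OF ind sa sa f])
  also have "\<dots> = (\<integral>\<^sup>+w. (\<Prod>src\<in>set ss. indicator (B src) w *
      ennreal (\<Prod>k\<in>UNIV. poisson_mass (lam k * duration src w) (d src k))) \<partial>M)"
  proof (rule nn_integral_cong)
    fix w assume w: "w \<in> space M"
    let ?I = "{w'\<in>space M. \<forall>i<?L. \<forall>k. N k (clock ss (Suc i) w) w' - N k (clock ss i w) w' = d (ss ! i) k}"
    have [measurable]: "(\<lambda>w'. N k (clock ss i w) w') \<in> measurable M (count_space UNIV)" for k i
      using clock_nonneg[OF w] by (rule N_measurable)
    have "{w'\<in>space M. \<forall>i\<in>{..<?L}. \<forall>k\<in>UNIV. N k (clock ss (Suc i) w) w' - N k (clock ss i w) w' = d (ss ! i) k} \<in> events"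
      by measurable
    then have [measurable]: "?I \<in> events"
      by simp
    have "(\<integral>\<^sup>+w'. f w w' \<partial>M) = (\<integral>\<^sup>+w'. (\<Prod>i<?L. indicator (B (ss ! i)) w) * indicator ?I w' \<partial>M)"
    proof (rule nn_integral_cong)
      fix w' assume w': "w' \<in> space M"
      have "(\<Prod>i<?L. indicator (B (ss ! i)) w :: ennreal) = indicator {w\<in>space M. \<forall>i\<in>{..<?L}. w \<in> B (ss ! i)} w"
        using w by (auto simp: indicator_def prod_zero_iff)
      then show "f w w' = (\<Prod>i<?L. indicator (B (ss ! i)) w) * indicator ?I w'"
        using w w' by (auto simp: f_def space_pair_measure spc split: split_indicator)
    qed
    also have "\<dots> = (\<Prod>i<?L. indicator (B (ss ! i)) w) * emeasure M ?I"
      by (simp add: nn_integral_cmult)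
    also have "emeasure M ?I = ennreal (\<Prod>i<?L. \<Prod>k\<in>UNIV. poisson_mass (lam k * (clock ss (Suc i) w - clock ss i w)) (d (ss ! i) k))"
      using prob_increments[OF clock_mono[OF w] clock_nonneg[OF w], where L="?L" and d="\<lambda>i. d (ss ! i)"]
      by (simp add: emeasure_eq_measure)
    also have "\<dots> = (\<Prod>i<?L. ennreal (\<Prod>k\<in>UNIV. poisson_mass (lam k * duration (ss ! i) w) (d (ss ! i) k)))"
      using lam_pos[THEN less_imp_le] duration_nonneg[OF w]
      by (subst prod_ennreal) (auto simp: clock_def intro!: prod_nonneg poisson_mass_nonneg mult_nonneg_nonneg)
    also have "(\<Prod>i<?L. indicator (B (ss ! i)) w) * \<dots> = (\<Prod>i<?L. indicator (B (ss ! i)) w *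
      ennreal (\<Prod>k\<in>UNIV. poisson_mass (lam k * duration (ss ! i) w) (d (ss ! i) k)))"
      by (rule prod.distrib[symmetric])
    also have "\<dots> = (\<Prod>src\<in>set ss. indicator (B src) w *
      ennreal (\<Prod>k\<in>UNIV. poisson_mass (lam k * duration src w) (d src k)))"
      by (rule prod_list_index[OF distinct])
    finally show "(\<integral>\<^sup>+w'. f w w' \<partial>M) = \<dots>" .
  qed
  also have "\<dots> = (\<Prod>src\<in>set ss. step_mass src (B src) (d src))"
    unfolding step_mass_def
  proof (rule indep_vars_nn_integral)
    show "indep_vars (\<lambda>_. borel) (\<lambda>src w. indicator (B src) w *
      ennreal (\<Prod>k\<in>UNIV. poisson_mass (lam k * duration src w) (d src k))) (set ss)" (is "indep_vars _ ?X _")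
    proof (unfold indep_vars_def, intro conjI ballI)
      have X: "?X src \<in> borel_measurable (sigma (space M) (source_sets src))" if "src \<in> set ss" for src
      proof -
        note duration_measurable_source[of src, measurable]
        have [measurable]: "B src \<in> sets (sigma (space M) (source_sets src))"
          using B[OF that] by (simp add: sigma_algebra.sets_measure_of_eq[OF sigma_algebra_source_sets])
        show ?thesis
          unfolding poisson_mass_def by measurable
      qed
      show "?X src \<in> borel_measurable M" if "src \<in> set ss" for src
        by (rule measurable_from_source[OF X[OF that]])
      show "indep_sets (\<lambda>src. sigma_sets (space M) {?X src -` A \<inter> space M |A. A \<in> sets borel}) (set ss)"
      proof (rule indep_sets_mono[OF indep_source_sets subset_UNIV])
        fix src assume "src \<in> set ss"
        from measurable_sets[OF X[OF this]]
        have "{?X src -` A \<inter> space M |A. A \<in> sets borel} \<subseteq> source_sets src"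
          by (auto simp: space_measure_of_conv sigma_algebra.sets_measure_of_eq[OF sigma_algebra_source_sets])
        then show "sigma_sets (space M) {?X src -` A \<inter> space M |A. A \<in> sets borel} \<subseteq> source_sets src"
          by (rule sigma_algebra.sigma_sets_subset[OF sigma_algebra_source_sets])
      qed
    qed
  qed auto
  finally show ?thesis .
qed

section \<open>Histories that can be extended by a fresh source\<close>

lemma stage_range: "stage n \<in> {1..I}"
proof -
  have "0 < CARD('k)"
    by simp
  then have "0 < I"
    using stages by linarith
  then have "n mod I < I"
    by simp
  then show ?thesis
    by (simp add: stage_def)
qed

text \<open>A history: \<open>U\<close> are the sources consumed so far and \<open>\<tau>\<close> is
  the current time. The list behind the trace is hidden, since an extension only has to know that
  its source is outside \<open>U\<close>.\<close>

definition observable :: "'k source set \<Rightarrow> ('w \<Rightarrow> real) \<Rightarrow> 'w set \<Rightarrow> bool" where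
  "observable U \<tau> A \<longleftrightarrow> (\<exists>ss B d. distinct ss \<and> set ss = U \<and> U \<inter> range Arrivals = {} \<and>
     (\<forall>src\<in>U. B src \<in> source_sets src) \<and> \<tau> = clock ss (length ss) \<and> A = trace ss B d)"

lemma observable_empty: "observable {} (\<lambda>_. 0) (space M)"
  unfolding observable_def by (rule exI[of _ "[]"]) (auto simp: clock_def trace_def)

lemma observableD:
  assumes "observable U \<tau> A"
  shows "A \<in> events" "\<tau> \<in> borel_measurable M" "w \<in> space M \<Longrightarrow> 0 \<le> \<tau> w"
proof -
  from assms obtain ss B d where ss: "distinct ss" "set ss = U" "\<forall>src\<in>U. B src \<in> source_sets src"
    and \<tau>: "\<tau> = clock ss (length ss)" and A: "A = trace ss B d"
    unfolding observable_def by auto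
  show "A \<in> events"
    unfolding A using ss source_sets_events by (intro trace_events) auto
  show "\<tau> \<in> borel_measurable M"
    unfolding \<tau> by measurable
  show "w \<in> space M \<Longrightarrow> 0 \<le> \<tau> w"
    unfolding \<tau> by (rule clock_nonneg)
qed

text \<open>This takes the place of the strong Markov property at the random time
  \<open>\<tau>\<close>: by the product formula for traces, a fresh source multiplies the
  probability by its own \<open>step_mass\<close>, whatever the history was.\<close>

lemma observable_step:
  fixes e :: "'k \<Rightarrow> nat"
  assumes obs: "observable U \<tau> A" and fresh: "src \<notin> U" "src \<notin> range Arrivals" and C: "C \<in> source_sets src"
  defines "A' \<equiv> A \<inter> {w\<in>space M. w \<in> C \<and> (\<forall>k. N k (\<tau> w + duration src w) w - N k (\<tau> w) w = e k)}"
  shows "observable (insert src U) (\<lambda>w. \<tau> w + duration src w) A'"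
    and "emeasure M A' = emeasure M A * step_mass src C e"
proof -
  from obs obtain ss B d where ss: "distinct ss" "set ss = U" "U \<inter> range Arrivals = {}"
      "\<forall>src\<in>U. B src \<in> source_sets src"
    and \<tau>: "\<tau> = clock ss (length ss)" and A: "A = trace ss B d"
    unfolding observable_def by auto
  let ?ss = "ss @ [src]" and ?B = "B(src := C)" and ?d = "d(src := e)"
  have clock_old: "clock ?ss i w = clock ss i w" if "i \<le> length ss" for i w
    using that by (auto simp: clock_def nth_append intro!: sum.cong)
  have clock_new: "clock ?ss (Suc (length ss)) w = \<tau> w + duration src w" for w
    using clock_old[of "length ss" w] by (simp add: \<tau> clock_def)
  have old: "?B (ss ! i) = B (ss ! i)" "?d (ss ! i) = d (ss ! i)" if "i < length ss" for i
    using fresh(1) ss(2) nth_mem[OF that] by auto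
  have A': "A' = trace ?ss ?B ?d"
    unfolding A'_def A trace_def length_append_singleton All_less_Suc
    using old by (auto simp: nth_append clock_old clock_new \<tau>)
  show "observable (insert src U) (\<lambda>w. \<tau> w + duration src w) A'"
    unfolding observable_def
    by (intro exI[of _ ?ss] exI[of _ ?B] exI[of _ ?d])
       (use ss fresh C in \<open>auto simp: A' clock_new fun_eq_iff\<close>)
  have "emeasure M A' = (\<Prod>s\<in>set ?ss. step_mass s (?B s) (?d s))"
    unfolding A' using ss fresh C by (intro emeasure_trace) auto
  also have "\<dots> = step_mass src C e * (\<Prod>s\<in>set ss. step_mass s (?B s) (?d s))"
    using fresh ss(2) finite_set[of ss] by simp
  also have "(\<Prod>s\<in>set ss. step_mass s (?B s) (?d s)) = (\<Prod>s\<in>set ss. step_mass s (B s) (d s))"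
    using fresh ss by (intro prod.cong) auto
  also have "\<dots> = emeasure M A"
    unfolding A using ss by (intro emeasure_trace[symmetric]) auto
  finally show "emeasure M A' = emeasure M A * step_mass src C e"
    by (simp add: mult.commute)
qed

text \<open>A selection takes no time, so prescribing zero arrivals costs nothing and the binomial
  probability remains.\<close>

lemma step_mass_Selection:
  "step_mass (Selection n) {w\<in>space M. Y n x w = y} (\<lambda>_. 0) = ennreal (pmf (binomial_pmf x (r (stage n))) y)"
proof -
  note Y_measurable[measurable]
  have "step_mass (Selection n) {w\<in>space M. Y n x w = y} (\<lambda>_. 0) = emeasure M {w\<in>space M. Y n x w = y}"
    by (simp add: step_mass_def poisson_mass_0)
  also have "\<dots> = emeasure (distr M (count_space UNIV) (Y n x)) {y}"
    by (subst emeasure_distr) (auto simp: Y_measurable intro!: arg_cong[where f="emeasure M"])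
  also have "\<dots> = ennreal (pmf (binomial_pmf x (r (stage n))) y)"
    unfolding Y_distr stage_def by (simp add: emeasure_pmf_single)
  finally show ?thesis .
qed

text \<open>Given the duration, the arrivals are independent Poisson variables, whose joint
  generating function is exponential in the duration; Tonelli exchanges the sum over
  \<open>d\<close> with the expectation.\<close>

lemma nn_integral_step_mass:
  fixes y :: "'k \<Rightarrow> real"
  assumes y: "\<And>k. 0 \<le> y k"
  shows "(\<integral>\<^sup>+d. step_mass src (space M) d * ennreal (weight y d) \<partial>count_space UNIV) =
    (\<integral>\<^sup>+w. ennreal (exp ((\<Sum>k\<in>UNIV. lam k * (y k - 1)) * duration src w)) \<partial>M)"
proof -
  have [measurable]: "(\<lambda>w. \<Prod>k\<in>UNIV. poisson_mass (lam k * duration src w) (d k)) \<in> borel_measurable M" for d :: "'k \<Rightarrow> nat"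
    unfolding poisson_mass_def by measurable
  have "step_mass src (space M) d * ennreal (weight y d) =
     (\<integral>\<^sup>+w. ennreal (\<Prod>k\<in>UNIV. poisson_mass (lam k * duration src w) (d k) * y k ^ d k) \<partial>M)" for d
  proof -
    have "step_mass src (space M) d * ennreal (weight y d) =
      (\<integral>\<^sup>+w. ennreal (\<Prod>k\<in>UNIV. poisson_mass (lam k * duration src w) (d k)) * ennreal (weight y d) \<partial>M)"
      unfolding step_mass_def by (subst nn_integral_multc[symmetric]) (auto intro!: nn_integral_cong)
    also have "\<dots> = (\<integral>\<^sup>+w. ennreal (\<Prod>k\<in>UNIV. poisson_mass (lam k * duration src w) (d k) * y k ^ d k) \<partial>M)"
      using weight_nonneg[of y d, OF y]
      by (intro nn_integral_cong) (simp add: ennreal_mult''[symmetric] weight_def prod.distrib)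
    finally show ?thesis .
  qed
  then have "(\<integral>\<^sup>+d. step_mass src (space M) d * ennreal (weight y d) \<partial>count_space UNIV) =
    (\<integral>\<^sup>+d. \<integral>\<^sup>+w. ennreal (\<Prod>k\<in>UNIV. poisson_mass (lam k * duration src w) (d k) * y k ^ d k) \<partial>M \<partial>count_space UNIV)"
    by simp
  also have "\<dots> = (\<integral>\<^sup>+w. \<integral>\<^sup>+d. ennreal (\<Prod>k\<in>UNIV. poisson_mass (lam k * duration src w) (d k) * y k ^ d k) \<partial>count_space UNIV \<partial>M)"
    unfolding poisson_mass_def by (subst nn_integral_count_space_nn_integral) auto
  also have "\<dots> = (\<integral>\<^sup>+w. ennreal (exp ((\<Sum>k\<in>UNIV. lam k * (y k - 1)) * duration src w)) \<partial>M)"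
  proof (rule nn_integral_cong)
    fix w assume "w \<in> space M"
    then have "0 \<le> lam k * duration src w" for k
      using lam_pos[of k] duration_nonneg by (simp add: less_imp_le)
    then show "(\<integral>\<^sup>+d. ennreal (\<Prod>k\<in>UNIV. poisson_mass (lam k * duration src w) (d k) * y k ^ d k) \<partial>count_space UNIV) =
      ennreal (exp ((\<Sum>k\<in>UNIV. lam k * (y k - 1)) * duration src w))"
      using y by (subst nn_integral_prod_poisson_mass) (auto simp: sum_distrib_left mult_ac)
  qed
  finally show ?thesis .
qed

section \<open>Measurability of the polling process\<close>

text \<open>The condition under the \<open>LEAST\<close> in \<open>services\<close>, evaluated at
  the actual start of visit \<open>n\<close>; thus \<open>LEAST m. cleared n m w\<close> is the
  number of services in that visit.\<close>

definition cleared :: "nat \<Rightarrow> nat \<Rightarrow> 'w \<Rightarrow> bool" where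
  "cleared n m w \<longleftrightarrow> (let t = polling_epoch n w; x = polling_queue n w (p (stage n)) in
     x + (N (p (stage n)) (completion n t m w) w - N (p (stage n)) t w) - m \<le> x - Y n x w)"

lemma polling_0: "polling_epoch 0 w = 0" "polling_queue 0 w = X0 w"
  by (simp_all add: polling_epoch_def polling_queue_def)

lemma polling_Suc:
  "polling_epoch (Suc n) w = completion n (polling_epoch n w) (LEAST m. cleared n m w) w + V n w"
  "polling_queue (Suc n) w k = polling_queue n w k +
    (N k (polling_epoch (Suc n) w) w - N k (polling_epoch n w) w) -
    (if k = p (stage n) then LEAST m. cleared n m w else 0)"
  by (simp_all add: polling_epoch_def polling_queue_def cleared_def services_def Let_def split_beta)

lemma polling_epoch_nonneg: "w \<in> space M \<Longrightarrow> 0 \<le> polling_epoch n w"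
  by (induction n) (auto simp: polling_0 polling_Suc completion_def S_nonneg V_nonneg intro!: add_nonneg_nonneg sum_nonneg)

lemma completion_nonneg: "w \<in> space M \<Longrightarrow> 0 \<le> completion n (polling_epoch n w) m w"
  by (auto simp: completion_def S_nonneg polling_epoch_nonneg intro!: add_nonneg_nonneg sum_nonneg)

text \<open>Measurability of the polling state is a hypothesis because this is a part of the
  induction step that establishes it.\<close>

lemma cleared_measurable':
  assumes [measurable]: "polling_epoch n \<in> borel_measurable M"
    "polling_queue n \<in> measurable M (count_space UNIV)"
  shows "Measurable.pred M (cleared n m)"
proof -
  note S_measurable[measurable] Y_measurable[measurable]
  have [measurable]: "(\<lambda>w. polling_queue n w k) \<in> measurable M (count_space UNIV)" for k
    by (rule measurable_compose[OF assms(2)]) simp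
  have c: "(\<lambda>w. completion n (polling_epoch n w) m w) \<in> borel_measurable M"
    unfolding completion_def by measurable
  have [measurable]: "(\<lambda>w. N k (polling_epoch n w) w) \<in> measurable M (count_space UNIV)"
      "(\<lambda>w. N k (completion n (polling_epoch n w) m w) w) \<in> measurable M (count_space UNIV)" for k
    using c by (auto intro!: N_at_random_time polling_epoch_nonneg completion_nonneg)
  have [measurable]: "(\<lambda>w. Y n (polling_queue n w (p (stage n))) w) \<in> measurable M (count_space UNIV)"
    by (rule measurable_compose_countable[where f="\<lambda>x w. Y n x w" and g="\<lambda>w. polling_queue n w (p (stage n))"])
       (simp_all add: Y_measurable)
  have "Measurable.pred M (\<lambda>w. a w + (b w - c w) - m \<le> a w - y w)"
    if a: "a \<in> measurable M (count_space UNIV)" and b: "b \<in> measurable M (count_space UNIV)"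
      and c: "c \<in> measurable M (count_space UNIV)" and y: "y \<in> measurable M (count_space UNIV)"
    for a b c y :: "'w \<Rightarrow> nat"
    by (rule measurable_compose_countable[OF _ a, where f="\<lambda>i w. i + (b w - c w) - m \<le> i - y w"])
       (rule measurable_compose_countable[OF _ b], rule measurable_compose_countable[OF _ c],
        rule measurable_compose_countable[OF _ y], simp)
  then show ?thesis
    unfolding cleared_def Let_def by simp
qed

lemma polling_measurable:
  "polling_epoch n \<in> borel_measurable M \<and> polling_queue n \<in> measurable M (count_space UNIV)"
proof (induction n)
  case 0
  have "polling_epoch 0 = (\<lambda>_. 0)" "polling_queue 0 = X0"
    by (simp_all add: fun_eq_iff polling_0)
  then show ?case
    using X0_measurable by simp
next
  case (Suc n)
  then have [measurable]: "polling_epoch n \<in> borel_measurable M" "polling_queue n \<in> measurable M (count_space UNIV)"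
    by auto
  have [measurable]: "(\<lambda>w. polling_queue n w k) \<in> measurable M (count_space UNIV)" for k
    by (rule measurable_compose[OF \<open>polling_queue n \<in> measurable M (count_space UNIV)\<close>]) simp
  note S_measurable[measurable] V_measurable[measurable] cleared_measurable'[of n, measurable]
  have [measurable]: "(\<lambda>w. completion n (polling_epoch n w) (LEAST m. cleared n m w) w) \<in> borel_measurable M"
    by (rule measurable_compose_countable[where f="\<lambda>m w. completion n (polling_epoch n w) m w"])
       (unfold completion_def, measurable)
  have epoch [measurable]: "polling_epoch (Suc n) \<in> borel_measurable M"
    unfolding polling_Suc(1)[abs_def] by measurable
  have [measurable]: "(\<lambda>w. N k (polling_epoch i w) w) \<in> measurable M (count_space UNIV)" if "i \<in> {n, Suc n}" for k i
    using that by (intro N_at_random_time polling_epoch_nonneg) auto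
  have "polling_queue (Suc n) \<in> measurable M (count_space UNIV)"
    by (rule measurable_count_space_fun) (simp add: polling_Suc(2))
  with epoch show ?case ..
qed

lemmas polling_epoch_measurable [measurable] = polling_measurable[THEN conjunct1]
  and polling_queue_measurable [measurable] = polling_measurable[THEN conjunct2]

lemma cleared_measurable [measurable]: "Measurable.pred M (cleared n m)"
  by (rule cleared_measurable') measurable

end

section \<open>The exponential drift of a visit\<close>

text \<open>The analytic input. During a visit, a customer due for service has the base
  \<open>\<zeta>\<close> instead of \<open>z\<close>. By \<open>service_drift\<close>, replacing one
  due customer by the arrivals during its service multiplies the mean weight by at most
  \<open>\<eta>\<close>; the exponential is the generating function of these arrivals given the
  service time. Likewise, \<open>C\<close> bounds the mean weight of the arrivals during a
  switchover.\<close>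

locale bep_drift = bep_polling +
  fixes z \<zeta> :: "'b \<Rightarrow> real" and C \<eta> :: real
  assumes \<zeta>_ge_1: "\<And>k. 1 \<le> \<zeta> k" and \<zeta>_less: "\<And>k. \<zeta> k < z k"
    and \<eta>: "0 \<le> \<eta>" "\<eta> < 1" and C_nonneg: "0 \<le> C"
    and service_drift: "\<And>n j. (\<integral>\<^sup>+w. ennreal (exp ((\<Sum>i\<in>UNIV. lam i *
      ((z(p (stage n) := \<zeta> (p (stage n)))) i - 1)) * S n j w)) \<partial>M) \<le> ennreal (\<eta> * \<zeta> (p (stage n)))"
    and switchover_drift: "\<And>n. (\<integral>\<^sup>+w. ennreal (exp ((\<Sum>i\<in>UNIV. lam i * (z i - 1)) * V n w)) \<partial>M) \<le> ennreal C"
begin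

text \<open>The bases in use vary from visit to visit but stay below those in the locale
  assumptions; the rate in the exponential increases with the bases, so a bound at the largest ones
  suffices.\<close>

lemma step_mass_bound:
  assumes y: "\<And>k. 0 \<le> y k" "\<And>k. y k \<le> y' k"
  shows "(\<integral>\<^sup>+d. step_mass src (space M) d * ennreal (weight y d) \<partial>count_space UNIV) \<le>
    (\<integral>\<^sup>+w. ennreal (exp ((\<Sum>k\<in>UNIV. lam k * (y' k - 1)) * duration src w)) \<partial>M)"
  unfolding nn_integral_step_mass[of y, OF y(1)]
proof (rule nn_integral_mono)
  fix w assume "w \<in> space M"
  then have "0 \<le> duration src w"
    by (rule duration_nonneg)
  moreover have "(\<Sum>k\<in>UNIV. lam k * (y k - 1)) \<le> (\<Sum>k\<in>UNIV. lam k * (y' k - 1))"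
    using y lam_pos by (intro sum_mono mult_left_mono) (auto intro: less_imp_le)
  ultimately show "ennreal (exp ((\<Sum>k\<in>UNIV. lam k * (y k - 1)) * duration src w)) \<le>
    ennreal (exp ((\<Sum>k\<in>UNIV. lam k * (y' k - 1)) * duration src w))"
    by (intro ennreal_leI) (simp add: mult_right_mono)
qed

lemma service_step_bound:
  assumes u: "\<And>k. 0 \<le> u k" "\<And>k. u k \<le> z k" and k_def: "k = p (stage n)"
  shows "(\<integral>\<^sup>+d. step_mass (Service_time n j) (space M) d * ennreal (weight (u(k := \<zeta> k)) d) \<partial>count_space UNIV)
    \<le> ennreal (\<eta> * \<zeta> k)"
proof -
  have "0 \<le> \<zeta> k"
    using \<zeta>_ge_1[of k] by simp
  then have "(\<integral>\<^sup>+d. step_mass (Service_time n j) (space M) d * ennreal (weight (u(k := \<zeta> k)) d) \<partial>count_space UNIV)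
    \<le> (\<integral>\<^sup>+w. ennreal (exp ((\<Sum>i\<in>UNIV. lam i * ((z(k := \<zeta> k)) i - 1)) * duration (Service_time n j) w)) \<partial>M)"
    using u by (intro step_mass_bound) auto
  also have "\<dots> \<le> ennreal (\<eta> * \<zeta> k)"
    using service_drift[of n j] by (simp add: k_def)
  finally show ?thesis .
qed

lemma switchover_step_bound:
  assumes u: "\<And>k. 0 \<le> u k" "\<And>k. u k \<le> z k"
  shows "(\<integral>\<^sup>+d. step_mass (Switchover n) (space M) d * ennreal (weight u d) \<partial>count_space UNIV) \<le> ennreal C"
  using order_trans[OF step_mass_bound[of u z "Switchover n", OF u] switchover_drift[of n, folded duration_simps(2)]] .

text \<open>The full polling state is fixed on \<open>A\<close>, so its weight is a constant there;
  the sources of visit \<open>n\<close> and of all later ones are kept fresh for the steps to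
  come.\<close>

definition at_poll :: "nat \<Rightarrow> 'b source set \<Rightarrow> ('a \<Rightarrow> real) \<Rightarrow> 'a set \<Rightarrow> ('b \<Rightarrow> nat) \<Rightarrow> bool" where
  "at_poll n U \<tau> A q \<longleftrightarrow> observable U \<tau> A \<and>
     (\<forall>i\<ge>n. Selection i \<notin> U \<and> Switchover i \<notin> U \<and> (\<forall>j. Service_time i j \<notin> U)) \<and>
     (\<forall>w\<in>A. polling_epoch n w = \<tau> w \<and> polling_queue n w = q)"

text \<open>
  Visit \<open>n\<close> after \<open>m\<close> services: \<open>q\<close> is the queue at the start of the visit, \<open>y\<close> the number of
  selected customers, and \<open>a\<close> counts the arrivals since then, so that \<open>y + a (p (stage n)) - m\<close> is
  the number of services that are still due without further arrivals.
\<close>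

definition in_visit :: "nat \<Rightarrow> nat \<Rightarrow> 'b source set \<Rightarrow> ('a \<Rightarrow> real) \<Rightarrow> 'a set \<Rightarrow> ('b \<Rightarrow> nat) \<Rightarrow> nat \<Rightarrow> ('b \<Rightarrow> nat) \<Rightarrow> bool" where
  "in_visit n m U \<tau> A q y a \<longleftrightarrow> observable U \<tau> A \<and>
     (\<forall>i>n. Selection i \<notin> U \<and> Switchover i \<notin> U \<and> (\<forall>j. Service_time i j \<notin> U)) \<and>
     Switchover n \<notin> U \<and> (\<forall>j\<ge>m. Service_time n j \<notin> U) \<and>
     y \<le> q (p (stage n)) \<and> m \<le> y + a (p (stage n)) \<and>
     (\<forall>w\<in>A. polling_queue n w = q \<and> Y n (q (p (stage n))) w = y \<and>
        \<tau> w = completion n (polling_epoch n w) m w \<and>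
        (\<forall>k. N k (\<tau> w) w - N k (polling_epoch n w) w = a k) \<and> (\<forall>m'<m. \<not> cleared n m' w))"

text \<open>The customers that are not due in the current visit: at the visited queue these are the
  unselected ones. The due customers there are weighted separately by a power of
  \<open>\<zeta>\<close>.\<close>

abbreviation remaining :: "nat \<Rightarrow> ('b \<Rightarrow> nat) \<Rightarrow> nat \<Rightarrow> ('b \<Rightarrow> nat) \<Rightarrow> 'b \<Rightarrow> nat" where
  "remaining n q y a \<equiv> (\<lambda>k. q k + a k)(p (stage n) := q (p (stage n)) - y)"

text \<open>The condition reads x + a - m \<le> x - y, which for y \<le> x means y + a \<le> m; the
  invariant \<open>in_visit\<close> supplies the reverse inequality.\<close>

lemma cleared_in_visit:
  assumes "in_visit n m U \<tau> A q y a" "w \<in> A"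
  shows "cleared n m w \<longleftrightarrow> y + a (p (stage n)) = m"
  using assms unfolding in_visit_def cleared_def Let_def by (auto simp: le_diff_conv)

text \<open>The arrivals \<open>d\<close> multiply the weight by their own, with base
  \<open>\<zeta> k\<close> at the visited queue, because customers arriving there become due. The
  hypothesis keeps the subtraction from truncating.\<close>

lemma weight_service:
  assumes "m < y + a k"
  shows "weight x ((\<lambda>j. q j + (a j + d j))(k := b)) * \<zeta> k ^ (y + (a k + d k) - Suc m) =
    weight x ((\<lambda>j. q j + a j)(k := b)) * \<zeta> k ^ (y + a k - Suc m) * weight (x(k := \<zeta> k)) d"
proof -
  have "(\<lambda>j. q j + (a j + d j))(k := b) = (\<lambda>j. ((\<lambda>j. q j + a j)(k := b)) j + (d(k := 0)) j)"
    by (auto simp: fun_eq_iff)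
  then have 1: "weight x ((\<lambda>j. q j + (a j + d j))(k := b)) = weight x ((\<lambda>j. q j + a j)(k := b)) * weight x (d(k := 0))"
    by (simp only: weight_add)
  have "y + (a k + d k) - Suc m = (y + a k - Suc m) + d k"
    using assms by simp
  then show ?thesis
    unfolding 1 weight_upd_base by (simp add: power_add)
qed

text \<open>The supermartingale step: \<open>A\<close> is cut by the arrivals during one service,
  and the bounds after that service are summed. \<open>\<nu>\<close> and \<open>E\<close> are free
  because the step serves twice: with \<open>M\<close> and non-termination for the tail of the
  number of services, and with a general \<open>\<nu>\<close> and termination within a bounded
  number of services for the weight.\<close>

lemma service_split:
  assumes visit: "in_visit n m U \<tau> A q y a" and pending: "m < y + a (p (stage n))"
    and \<nu>: "sets \<nu> = sets M" and E: "E \<in> events"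
    and x: "\<And>k. 0 \<le> x k" "\<And>k. x k \<le> z k" and c: "0 \<le> c"
    and later: "\<And>U' \<tau>' A' d. in_visit n (Suc m) U' \<tau>' A' q y (\<lambda>k. a k + d k) \<Longrightarrow>
      emeasure \<nu> (A' \<inter> E) \<le> ennreal (c * (weight x (remaining n q y (\<lambda>k. a k + d k)) *
        \<zeta> (p (stage n)) ^ (y + (a (p (stage n)) + d (p (stage n))) - Suc m))) * emeasure M A'"
  shows "emeasure \<nu> (A \<inter> E) \<le> ennreal (c * \<eta> * (weight x (remaining n q y a) *
    \<zeta> (p (stage n)) ^ (y + a (p (stage n)) - m))) * emeasure M A"
proof -
  define k where "k = p (stage n)"
  let ?src = "Service_time n m"
  \<comment> \<open>The exponent is that after the departure; the missing factor
    \<open>\<zeta> k\<close> comes back from \<open>service_step_bound\<close>.\<close>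
  define W where "W = c * (weight x (remaining n q y a) * \<zeta> k ^ (y + a k - Suc m))"
  have obs: "observable U \<tau> A"
    using visit by (simp add: in_visit_def)
  have [measurable]: "A \<in> events" "\<tau> \<in> borel_measurable M" "E \<in> events"
    using observableD[OF obs] E by auto
  have \<zeta>_nonneg: "0 \<le> \<zeta> k"
    using \<zeta>_ge_1[of k] by simp
  have W: "0 \<le> W"
    unfolding W_def using c x \<zeta>_nonneg by (intro mult_nonneg_nonneg weight_nonneg) auto
  define H where "H w k = N k (\<tau> w + S n m w) w - N k (\<tau> w) w" for w k
  have [measurable]: "H \<in> measurable M (count_space UNIV)"
  proof (rule measurable_count_space_fun)
    note S_measurable[measurable]
    have [measurable]: "(\<lambda>w. N k (\<tau> w + S n m w) w) \<in> measurable M (count_space UNIV)"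
        "(\<lambda>w. N k (\<tau> w) w) \<in> measurable M (count_space UNIV)" for k
      using observableD(3)[OF obs] by (auto intro!: N_at_random_time S_nonneg add_nonneg_nonneg)
    show "(\<lambda>w. H w k) \<in> measurable M (count_space UNIV)" for k
      unfolding H_def by measurable
  qed
  have step: "emeasure \<nu> (A \<inter> E \<inter> {w\<in>space \<nu>. H w = d}) \<le>
    ennreal W * emeasure M A * (step_mass ?src (space M) d * ennreal (weight (x(k := \<zeta> k)) d))" for d
  proof -
    let ?A = "A \<inter> {w\<in>space M. w \<in> space M \<and> (\<forall>k. N k (\<tau> w + duration ?src w) w - N k (\<tau> w) w = d k)}"
    have fresh: "?src \<notin> U" "?src \<notin> range Arrivals"
      using visit by (auto simp: in_visit_def)
    have sp: "space M \<in> source_sets ?src"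
    proof -
      interpret C: sigma_algebra "space M" "source_sets ?src"
        by (rule sigma_algebra_source_sets)
      show ?thesis
        by (rule C.top)
    qed
    note next_obs = observable_step[OF obs fresh sp, of d]
    have A_eq: "A \<inter> {w\<in>space M. H w = d} = ?A"
      by (auto simp: H_def fun_eq_iff)
    have "in_visit n (Suc m) (insert ?src U) (\<lambda>w. \<tau> w + duration ?src w) ?A q y (\<lambda>k. a k + d k)"
      unfolding in_visit_def
    proof (intro conjI ballI allI impI)
      fix w assume w: "w \<in> ?A"
      then have wA: "w \<in> A" and ws: "w \<in> space M" and d: "\<And>k. N k (\<tau> w + S n m w) w - N k (\<tau> w) w = d k"
        by auto
      have \<tau>: "\<tau> w = completion n (polling_epoch n w) m w" and a: "\<And>k. N k (\<tau> w) w - N k (polling_epoch n w) w = a k"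
        using visit wA by (auto simp: in_visit_def)
      show "\<tau> w + duration ?src w = completion n (polling_epoch n w) (Suc m) w"
        by (simp add: \<tau> completion_def)
      fix k
      have "N k (polling_epoch n w) w \<le> N k (\<tau> w) w"
        by (rule N_mono[OF ws polling_epoch_nonneg[OF ws]])
           (simp add: \<tau> completion_def sum_nonneg S_nonneg ws)
      moreover have "N k (\<tau> w) w \<le> N k (\<tau> w + S n m w) w"
        using observableD(3)[OF obs ws] S_nonneg[OF ws] by (intro N_mono[OF ws]) auto
      ultimately show "N k (\<tau> w + duration ?src w) w - N k (polling_epoch n w) w = a k + d k"
        using a[of k] d[of k] by simp
    next
      fix w m' assume w: "w \<in> ?A" and "m' < Suc m"
      then consider "m' < m" | "m' = m"
        by linarith
      then show "\<not> cleared n m' w"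
      proof cases
        case 1
        then show ?thesis
          using visit w by (auto simp: in_visit_def)
      next
        case 2
        then show ?thesis
          using cleared_in_visit[OF visit, of w] w pending by auto
      qed
    qed (use visit pending next_obs(1) in \<open>auto simp: in_visit_def\<close>)
    from later[OF this] have "emeasure \<nu> (?A \<inter> E) \<le> ennreal (W * weight (x(k := \<zeta> k)) d) * emeasure M ?A"
      using weight_service[of m y a k x q d "q k - y", OF pending[folded k_def]] by (simp add: W_def k_def mult.assoc)
    also have "\<dots> = ennreal (W * weight (x(k := \<zeta> k)) d) * (emeasure M A * step_mass ?src (space M) d)"
      using next_obs(2) by simp
    also have "\<dots> = ennreal W * emeasure M A * (step_mass ?src (space M) d * ennreal (weight (x(k := \<zeta> k)) d))"
      using W by (simp add: ennreal_mult' mult_ac)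
    also have "?A \<inter> E = A \<inter> E \<inter> {w\<in>space \<nu>. H w = d}"
      using A_eq sets_eq_imp_space_eq[OF \<nu>] by auto
    finally show ?thesis .
  qed
  have "emeasure \<nu> (A \<inter> E) = (\<integral>\<^sup>+d. emeasure \<nu> (A \<inter> E \<inter> {w\<in>space \<nu>. H w = d}) \<partial>count_space UNIV)"
    by (rule emeasure_split_countable) (simp_all add: \<nu> measurable_cong_sets[OF \<nu> refl])
  also have "\<dots> \<le> (\<integral>\<^sup>+d. ennreal W * emeasure M A * (step_mass ?src (space M) d * ennreal (weight (x(k := \<zeta> k)) d)) \<partial>count_space UNIV)"
    by (intro nn_integral_mono step)
  also have "\<dots> = ennreal W * emeasure M A * (\<integral>\<^sup>+d. step_mass ?src (space M) d * ennreal (weight (x(k := \<zeta> k)) d) \<partial>count_space UNIV)"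
    by (rule nn_integral_cmult) simp
  also have "\<dots> \<le> ennreal W * emeasure M A * ennreal (\<eta> * \<zeta> k)"
    by (intro mult_left_mono service_step_bound[OF x k_def]) simp
  also have "\<dots> = ennreal (W * (\<eta> * \<zeta> k)) * emeasure M A"
    using W by (simp add: ennreal_mult' mult_ac)
  also have "W * (\<eta> * \<zeta> k) = c * \<eta> * (weight x (remaining n q y a) * \<zeta> k ^ (y + a k - m))"
  proof -
    have "y + a k - m = Suc (y + a k - Suc m)"
      using pending by (simp add: k_def)
    then show ?thesis
      by (simp add: W_def)
  qed
  finally show ?thesis
    by (simp add: k_def)
qed

section \<open>Almost sure termination of a visit\<close>

text \<open>With all bases except that of the due customers set to 1, the weight is a power of a
  number \<ge> 1, hence bounds an indicator from above, and its mean falls by \<open>\<eta>\<close>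
  with each service while the visit lasts.\<close>

lemma not_cleared_bound:
  assumes "in_visit n m U \<tau> A q y a"
  shows "emeasure M (A \<inter> {w\<in>space M. \<forall>m'\<in>{..m + L}. \<not> cleared n m' w}) \<le>
    ennreal (\<eta> ^ L * \<zeta> (p (stage n)) ^ (y + a (p (stage n)) - m)) * emeasure M A"
  using assms
proof (induction L arbitrary: m U \<tau> A a)
  case 0
  have "1 \<le> \<zeta> (p (stage n)) ^ (y + a (p (stage n)) - m)"
    using \<zeta>_ge_1 by (rule one_le_power)
  then have "1 * emeasure M A \<le> ennreal (\<zeta> (p (stage n)) ^ (y + a (p (stage n)) - m)) * emeasure M A"
    by (intro mult_right_mono) simp_all
  moreover have "emeasure M (A \<inter> {w\<in>space M. \<forall>m'\<in>{..m + 0}. \<not> cleared n m' w}) \<le> emeasure M A"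
    using observableD(1) 0 by (intro emeasure_mono) (auto simp: in_visit_def)
  ultimately show ?case
    by simp
next
  case (Suc L)
  let ?E = "{w\<in>space M. \<forall>m'\<in>{..m + Suc L}. \<not> cleared n m' w}"
  show ?case
  proof (cases "m < y + a (p (stage n))")
    case True
    have "emeasure M (A \<inter> ?E) \<le> ennreal (\<eta> ^ L * \<eta> * (weight (\<lambda>_. 1) (remaining n q y a) *
      \<zeta> (p (stage n)) ^ (y + a (p (stage n)) - m))) * emeasure M A"
    proof (rule service_split[OF Suc.prems True refl])
      show "?E \<in> events"
        by measurable
      show "(1 :: real) \<le> z k" for k
        using \<zeta>_ge_1[of k] \<zeta>_less[of k] by simp
      show "0 \<le> \<eta> ^ L"
        using \<eta> by simp
      fix U' \<tau>' A' and d :: "'b \<Rightarrow> nat"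
      assume "in_visit n (Suc m) U' \<tau>' A' q y (\<lambda>k. a k + d k)"
      from Suc.IH[OF this]
      show "emeasure M (A' \<inter> ?E) \<le> ennreal (\<eta> ^ L * (weight (\<lambda>_. 1) (remaining n q y (\<lambda>k. a k + d k)) *
        \<zeta> (p (stage n)) ^ (y + (a (p (stage n)) + d (p (stage n))) - Suc m))) * emeasure M A'"
        by (simp add: weight_def)
    qed simp
    then show ?thesis
      by (simp add: weight_def mult_ac)
  next
    case False
    then have "y + a (p (stage n)) = m"
      using Suc.prems by (simp add: in_visit_def)
    then have "cleared n m w" if "w \<in> A" for w
      using cleared_in_visit[OF Suc.prems that] by simp
    then have "A \<inter> ?E = {}"
      by (auto dest: bspec[where x=m])
    then show ?thesis
      by simp
  qed
qed

lemma cleared_AE: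
  assumes "in_visit n m U \<tau> A q y a"
  shows "emeasure M (A \<inter> {w\<in>space M. \<forall>m'. \<not> cleared n m' w}) = 0"
proof -
  let ?c = "\<zeta> (p (stage n)) ^ (y + a (p (stage n)) - m) * prob A"
  have A: "A \<in> events"
    using assms observableD(1) by (auto simp: in_visit_def)
  have [measurable]: "A \<in> events"
    by fact
  have "prob (A \<inter> {w\<in>space M. \<forall>m'. \<not> cleared n m' w}) \<le> \<eta> ^ L * ?c" for L
  proof -
    have "emeasure M (A \<inter> {w\<in>space M. \<forall>m'. \<not> cleared n m' w}) \<le>
        emeasure M (A \<inter> {w\<in>space M. \<forall>m'\<in>{..m + L}. \<not> cleared n m' w})"
      by (intro emeasure_mono) (auto, measurable)
    also have "\<dots> \<le> ennreal (\<eta> ^ L * \<zeta> (p (stage n)) ^ (y + a (p (stage n)) - m)) * emeasure M A"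
      by (rule not_cleared_bound[OF assms])
    also have "\<dots> = ennreal (\<eta> ^ L * ?c)"
      by (simp add: emeasure_eq_measure ennreal_mult''[symmetric] mult.assoc)
    finally show ?thesis
      using \<eta> \<zeta>_ge_1[of "p (stage n)"] by (simp add: emeasure_eq_measure)
  qed
  moreover have "(\<lambda>L. \<eta> ^ L * ?c) \<longlonglongrightarrow> 0 * ?c"
    using \<eta> by (intro tendsto_mult LIMSEQ_realpow_zero tendsto_const) auto
  ultimately have "prob (A \<inter> {w\<in>space M. \<forall>m'. \<not> cleared n m' w}) \<le> 0"
    by (intro LIMSEQ_le_const[where X="\<lambda>L. \<eta> ^ L * ?c"]) auto
  then show ?thesis
    by (simp add: emeasure_eq_measure measure_le_0_iff)
qed

section \<open>The weight across one visit\<close>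

text \<open>No customer is due any more, so the visit has exactly \<open>m\<close> services and the
  next step is the switchover, whose arrivals account for the factor \<open>C\<close>.\<close>

lemma departure_bound:
  assumes visit: "in_visit n m U \<tau> A q y a" and fin: "y + a (p (stage n)) = m"
    and \<nu>: "sets \<nu> = sets M"
    and u: "\<And>k. 0 \<le> u k" "\<And>k. u k \<le> z k" and c: "0 \<le> c"
    and later: "\<And>U' \<tau>' A' q'. at_poll (Suc n) U' \<tau>' A' q' \<Longrightarrow>
      emeasure \<nu> A' \<le> ennreal (c * weight u q') * emeasure M A'"
  shows "emeasure \<nu> A \<le> ennreal (c * C * weight u (remaining n q y a)) * emeasure M A"
proof -
  let ?src = "Switchover n"
  define W where "W = c * weight u (remaining n q y a)"
  have obs: "observable U \<tau> A"
    using visit by (simp add: in_visit_def)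
  have [measurable]: "A \<in> events" "\<tau> \<in> borel_measurable M"
    using observableD[OF obs] by auto
  have W: "0 \<le> W"
    unfolding W_def using c u by (intro mult_nonneg_nonneg weight_nonneg) auto
  define H where "H w k = N k (\<tau> w + V n w) w - N k (\<tau> w) w" for w k
  have [measurable]: "H \<in> measurable M (count_space UNIV)"
  proof (rule measurable_count_space_fun)
    note V_measurable[measurable]
    have [measurable]: "(\<lambda>w. N k (\<tau> w + V n w) w) \<in> measurable M (count_space UNIV)"
        "(\<lambda>w. N k (\<tau> w) w) \<in> measurable M (count_space UNIV)" for k
      using observableD(3)[OF obs] by (auto intro!: N_at_random_time V_nonneg add_nonneg_nonneg)
    show "(\<lambda>w. H w k) \<in> measurable M (count_space UNIV)" for k
      unfolding H_def by measurable
  qed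
  have step: "emeasure \<nu> (A \<inter> {w\<in>space \<nu>. H w = d}) \<le>
    ennreal W * emeasure M A * (step_mass ?src (space M) d * ennreal (weight u d))" for d
  proof -
    let ?A = "A \<inter> {w\<in>space M. w \<in> space M \<and> (\<forall>k. N k (\<tau> w + duration ?src w) w - N k (\<tau> w) w = d k)}"
    let ?q = "\<lambda>k. remaining n q y a k + d k"
    have fresh: "?src \<notin> U" "?src \<notin> range Arrivals"
      using visit by (auto simp: in_visit_def)
    have sp: "space M \<in> source_sets ?src"
    proof -
      interpret C: sigma_algebra "space M" "source_sets ?src"
        by (rule sigma_algebra_source_sets)
      show ?thesis
        by (rule C.top)
    qed
    note next_obs = observable_step[OF obs fresh sp, of d]
    have A_eq: "A \<inter> {w\<in>space M. H w = d} = ?A"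
      by (auto simp: H_def fun_eq_iff)
    have "at_poll (Suc n) (insert ?src U) (\<lambda>w. \<tau> w + duration ?src w) ?A ?q"
      unfolding at_poll_def
    proof (intro conjI ballI)
      fix w assume w: "w \<in> ?A"
      then have wA: "w \<in> A" and ws: "w \<in> space M" and d: "\<And>k. N k (\<tau> w + V n w) w - N k (\<tau> w) w = d k"
        by auto
      have \<tau>: "\<tau> w = completion n (polling_epoch n w) m w" and a: "\<And>k. N k (\<tau> w) w - N k (polling_epoch n w) w = a k"
        and q: "polling_queue n w = q" and y: "y \<le> q (p (stage n))"
        and before: "\<And>m'. m' < m \<Longrightarrow> \<not> cleared n m' w"
        using visit wA by (auto simp: in_visit_def)
      have "cleared n m w"
        using cleared_in_visit[OF visit wA] fin by simp
      then have least: "(LEAST m. cleared n m w) = m"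
        using before by (intro Least_equality) (auto simp: not_less[symmetric])
      show epoch: "polling_epoch (Suc n) w = \<tau> w + duration ?src w"
        by (simp add: polling_Suc least \<tau>)
      show "polling_queue (Suc n) w = ?q"
      proof
        fix k
        have "N k (polling_epoch n w) w \<le> N k (\<tau> w) w"
          by (rule N_mono[OF ws polling_epoch_nonneg[OF ws]])
             (simp add: \<tau> completion_def sum_nonneg S_nonneg ws)
        moreover have "N k (\<tau> w) w \<le> N k (\<tau> w + V n w) w"
          using observableD(3)[OF obs ws] V_nonneg[OF ws] by (intro N_mono[OF ws]) auto
        ultimately have "N k (\<tau> w + V n w) w - N k (polling_epoch n w) w = a k + d k"
          using a[of k] d[of k] by simp
        then show "polling_queue (Suc n) w k = ?q k"
          unfolding polling_Suc(2) epoch using fin y by (auto simp: least q)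
      qed
    qed (use visit next_obs(1) in \<open>auto simp: in_visit_def\<close>)
    from later[OF this] have "emeasure \<nu> ?A \<le> ennreal (W * weight u d) * emeasure M ?A"
      by (simp only: weight_add W_def mult.assoc)
    also have "\<dots> = ennreal (W * weight u d) * (emeasure M A * step_mass ?src (space M) d)"
      using next_obs(2) by simp
    also have "\<dots> = ennreal W * emeasure M A * (step_mass ?src (space M) d * ennreal (weight u d))"
      unfolding ennreal_mult'[OF W] by (simp only: mult_ac)
    also have "?A = A \<inter> {w\<in>space \<nu>. H w = d}"
      using A_eq sets_eq_imp_space_eq[OF \<nu>] by auto
    finally show ?thesis .
  qed
  have "emeasure \<nu> A = (\<integral>\<^sup>+d. emeasure \<nu> (A \<inter> {w\<in>space \<nu>. H w = d}) \<partial>count_space UNIV)"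
    by (rule emeasure_split_countable) (simp_all add: \<nu> measurable_cong_sets[OF \<nu> refl])
  also have "\<dots> \<le> (\<integral>\<^sup>+d. ennreal W * emeasure M A * (step_mass ?src (space M) d * ennreal (weight u d)) \<partial>count_space UNIV)"
    by (intro nn_integral_mono step)
  also have "\<dots> = ennreal W * emeasure M A * (\<integral>\<^sup>+d. step_mass ?src (space M) d * ennreal (weight u d) \<partial>count_space UNIV)"
    by (rule nn_integral_cmult) simp
  also have "\<dots> \<le> ennreal W * emeasure M A * ennreal C"
    by (intro mult_left_mono switchover_step_bound u) simp
  also have "\<dots> = ennreal (W * C) * emeasure M A"
    unfolding ennreal_mult'[OF W] by (simp only: mult_ac)
  also have "W * C = c * C * weight u (remaining n q y a)"
    by (simp add: W_def)
  finally show ?thesis .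
qed

text \<open>The number of services is unbounded, so the induction runs on the number
  \<open>L\<close> of further services allowed. The bound is free of \<open>L\<close>: the factor
  \<open>\<eta>\<close> gained at each service is estimated by 1.\<close>

lemma cleared_within_bound:
  assumes \<nu>: "sets \<nu> = sets M"
    and u: "\<And>k. 0 \<le> u k" "\<And>k. u k \<le> z k" and c: "0 \<le> c"
    and later: "\<And>U' \<tau>' A' q'. at_poll (Suc n) U' \<tau>' A' q' \<Longrightarrow>
      emeasure \<nu> A' \<le> ennreal (c * weight u q') * emeasure M A'"
    and visit: "in_visit n m U \<tau> A q y a"
  shows "emeasure \<nu> (A \<inter> {w\<in>space M. \<exists>m'\<in>{..m + L}. cleared n m' w}) \<le>
    ennreal (c * C * (weight u (remaining n q y a) * \<zeta> (p (stage n)) ^ (y + a (p (stage n)) - m))) * emeasure M A"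
  using visit
proof (induction L arbitrary: m U \<tau> A a)
  let ?E = "\<lambda>L m. {w\<in>space M. \<exists>m'\<in>{..m + L}. cleared n m' w}"
  have finished: "emeasure \<nu> (A \<inter> ?E L m) \<le>
    ennreal (c * C * (weight u (remaining n q y a) * \<zeta> (p (stage n)) ^ (y + a (p (stage n)) - m))) * emeasure M A"
    if visit: "in_visit n m U \<tau> A q y a" and fin: "y + a (p (stage n)) = m" for L m U \<tau> A a
  proof -
    have "A \<in> events"
      using visit observableD(1) by (auto simp: in_visit_def)
    then have "emeasure \<nu> (A \<inter> ?E L m) \<le> emeasure \<nu> A"
      using \<nu> by (intro emeasure_mono) auto
    also have "\<dots> \<le> ennreal (c * C * weight u (remaining n q y a)) * emeasure M A"
      by (rule departure_bound[OF visit fin \<nu> u c later])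
    finally show ?thesis
      using fin by simp
  qed
  {
    case 0
    show ?case
    proof (cases "y + a (p (stage n)) = m")
      case False
      then have "\<not> cleared n m' w" if "w \<in> A" "m' \<le> m" for w m'
        using cleared_in_visit[OF 0 that(1)] 0 that by (cases "m' = m") (auto simp: in_visit_def)
      then have "A \<inter> ?E 0 m = {}"
        by auto
      then show ?thesis
        by (simp only: emeasure_empty zero_le)
    qed (rule finished[OF 0])
  next
    case (Suc L)
    show ?case
    proof (cases "y + a (p (stage n)) = m")
      case False
      then have pending: "m < y + a (p (stage n))"
        using Suc.prems by (simp add: in_visit_def)
      have "emeasure \<nu> (A \<inter> ?E (Suc L) m) \<le> ennreal (c * C * \<eta> * (weight u (remaining n q y a) *
        \<zeta> (p (stage n)) ^ (y + a (p (stage n)) - m))) * emeasure M A"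
      proof (rule service_split[OF Suc.prems pending \<nu>])
        show "?E (Suc L) m \<in> events"
          by measurable
        show "0 \<le> c * C"
          using c C_nonneg by simp
        fix U' \<tau>' A' and d :: "'b \<Rightarrow> nat"
        assume "in_visit n (Suc m) U' \<tau>' A' q y (\<lambda>k. a k + d k)"
        from Suc.IH[OF this]
        show "emeasure \<nu> (A' \<inter> ?E (Suc L) m) \<le> ennreal (c * C * (weight u (remaining n q y (\<lambda>k. a k + d k)) *
          \<zeta> (p (stage n)) ^ (y + (a (p (stage n)) + d (p (stage n))) - Suc m))) * emeasure M A'"
          by (simp only: add_Suc add_Suc_right)
      qed (use u in auto)
      also have "\<dots> \<le> ennreal (c * C * (weight u (remaining n q y a) *
        \<zeta> (p (stage n)) ^ (y + a (p (stage n)) - m))) * emeasure M A"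
      proof (intro mult_right_mono ennreal_leI mult_nonneg_nonneg weight_nonneg)
        show "c * C * \<eta> \<le> c * C"
          using c C_nonneg \<eta> by (intro mult_right_le_one_le) auto
      qed (use u \<zeta>_ge_1[of "p (stage n)"] in auto)
      finally show ?thesis .
    qed (rule finished[OF Suc.prems])
  }
qed

text \<open>Monotone limit in \<open>L\<close>. Non-termination is a null event for
  \<open>M\<close>, and absolute continuity makes it one for \<open>\<nu>\<close>.\<close>

lemma service_phase_bound:
  assumes \<nu>: "sets \<nu> = sets M" and ac: "absolutely_continuous M \<nu>"
    and u: "\<And>k. 0 \<le> u k" "\<And>k. u k \<le> z k" and c: "0 \<le> c"
    and later: "\<And>U' \<tau>' A' q'. at_poll (Suc n) U' \<tau>' A' q' \<Longrightarrow>
      emeasure \<nu> A' \<le> ennreal (c * weight u q') * emeasure M A'"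
    and visit: "in_visit n m U \<tau> A q y a"
  shows "emeasure \<nu> A \<le>
    ennreal (c * C * (weight u (remaining n q y a) * \<zeta> (p (stage n)) ^ (y + a (p (stage n)) - m))) * emeasure M A"
proof -
  have [measurable]: "A \<in> events"
    using visit observableD(1) by (auto simp: in_visit_def)
  let ?F = "A \<inter> {w\<in>space M. \<forall>m'. \<not> cleared n m' w}"
  let ?E = "\<lambda>L. A \<inter> {w\<in>space M. \<exists>m'\<in>{..m + L}. cleared n m' w}"
  have E_events: "?E L \<in> events" and F_events: "?F \<in> events" for L
    by measurable
  have "?F \<in> null_sets M"
    using cleared_AE[OF visit] F_events by (rule null_setsI)
  then have null: "?F \<in> null_sets \<nu>"
    using ac unfolding absolutely_continuous_def by (rule subsetD[rotated])
  have "A \<subseteq> (\<Union>L. ?E L) \<union> ?F"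
  proof
    fix w assume w: "w \<in> A"
    then have ws: "w \<in> space M"
      using sets.sets_into_space[OF \<open>A \<in> events\<close>] by blast
    show "w \<in> (\<Union>L. ?E L) \<union> ?F"
    proof (cases "\<exists>m'. cleared n m' w")
      case True
      then obtain m' where "cleared n m' w"
        by blast
      moreover have "m' \<in> {..m + m'}"
        by simp
      ultimately have "w \<in> ?E m'"
        using w ws by blast
      then show ?thesis
        by blast
    next
      case False
      then show ?thesis
        using w ws by blast
    qed
  qed
  then have "emeasure \<nu> A \<le> emeasure \<nu> ((\<Union>L. ?E L) \<union> ?F)"
    by (rule emeasure_mono) (use E_events F_events \<nu> in \<open>simp add: sets.Un sets.countable_UN\<close>)
  also have "\<dots> = emeasure \<nu> (\<Union>L. ?E L)"
    using null by (intro emeasure_Un_null_set) (use E_events \<nu> in \<open>simp_all add: sets.countable_UN\<close>)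
  also have "\<dots> = (SUP L. emeasure \<nu> (?E L))"
  proof (rule SUP_emeasure_incseq[symmetric])
    show "range ?E \<subseteq> sets \<nu>"
      unfolding \<nu> by (rule image_subsetI) (rule E_events)
    show "incseq ?E"
    proof (rule incseq_SucI)
      show "?E L \<subseteq> ?E (Suc L)" for L
      proof
        fix w assume "w \<in> ?E L"
        then obtain m' where w: "w \<in> A" "w \<in> space M" "m' \<in> {..m + L}" "cleared n m' w"
          by auto
        then have "m' \<in> {..m + Suc L}"
          by simp
        with w show "w \<in> ?E (Suc L)"
          by (intro IntI CollectI conjI bexI[of _ m'])
      qed
    qed
  qed
  also have "\<dots> \<le> ennreal (c * C * (weight u (remaining n q y a) * \<zeta> (p (stage n)) ^ (y + a (p (stage n)) - m))) * emeasure M A"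
    by (intro SUP_least cleared_within_bound[OF \<nu> u c later visit])
  finally show ?thesis .
qed

section \<open>Bases pulled back through visits and cycles\<close>

text \<open>The mean contribution of one customer found in the visited queue: unselected it keeps
  its base in \<open>u\<close>, selected it counts with \<open>\<zeta>\<close>.\<close>

definition visit_back :: "nat \<Rightarrow> ('b \<Rightarrow> real) \<Rightarrow> 'b \<Rightarrow> real" where
  "visit_back n u = u(p (stage n) := (1 - r (stage n)) * u (p (stage n)) + r (stage n) * \<zeta> (p (stage n)))"

lemma r_stage: "r (stage n) \<in> {0..1}"
  using r_range[OF stage_range] .

lemma visit_bound:
  assumes \<nu>: "sets \<nu> = sets M" and ac: "absolutely_continuous M \<nu>"
    and u: "\<And>k. 0 \<le> u k" "\<And>k. u k \<le> z k" and c: "0 \<le> c"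
    and later: "\<And>U' \<tau>' A' q'. at_poll (Suc n) U' \<tau>' A' q' \<Longrightarrow>
      emeasure \<nu> A' \<le> ennreal (c * weight u q') * emeasure M A'"
    and poll: "at_poll n U \<tau> A q"
  shows "emeasure \<nu> A \<le> ennreal (c * C * weight (visit_back n u) q) * emeasure M A"
proof -
  define k where "k = p (stage n)"
  define x where "x = q k"
  define W where "W = c * C * weight u (q(k := 0))"
  let ?b = "binomial_pmf x (r (stage n))"
  have obs: "observable U \<tau> A"
    using poll by (simp add: at_poll_def)
  have [measurable]: "A \<in> events"
    using observableD[OF obs] by auto
  have \<zeta>_nonneg: "0 \<le> \<zeta> k"
    using \<zeta>_ge_1[of k] by simp
  have W: "0 \<le> W"
    unfolding W_def using c u C_nonneg by (intro mult_nonneg_nonneg weight_nonneg) auto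
  have step: "emeasure \<nu> (A \<inter> {w\<in>space \<nu>. Y n x w = y}) \<le>
    ennreal W * emeasure M A * (ennreal (pmf ?b y) * ennreal (u k ^ (x - y) * \<zeta> k ^ y))" for y
  proof -
    let ?src = "Selection n"
    let ?B = "{w\<in>space M. Y n x w = y}"
    let ?A = "A \<inter> {w\<in>space M. w \<in> ?B \<and> (\<forall>k. N k (\<tau> w + duration ?src w) w - N k (\<tau> w) w = (0 :: nat))}"
    have fresh: "?src \<notin> U" "?src \<notin> range Arrivals"
      using poll by (auto simp: at_poll_def)
    have B: "?B \<in> source_sets ?src"
    proof -
      have "?B = Y n x -` {y} \<inter> space M"
        by auto
      then show ?thesis
        by (auto simp: source_sets_def intro!: sigma_sets.Basic)
    qed
    note next_obs = observable_step[OF obs fresh B, of "\<lambda>_. 0"]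
    have A_eq: "?A = A \<inter> {w\<in>space \<nu>. Y n x w = y}"
      using sets_eq_imp_space_eq[OF \<nu>] by auto
    have mass: "emeasure M ?A = emeasure M A * ennreal (pmf ?b y)"
      using next_obs(2) by (simp only: step_mass_Selection)
    have "emeasure \<nu> ?A \<le> ennreal W * emeasure M A * (ennreal (pmf ?b y) * ennreal (u k ^ (x - y) * \<zeta> k ^ y))"
    proof (cases "y \<le> x")
      case True
      have "in_visit n 0 (insert ?src U) (\<lambda>w. \<tau> w + duration ?src w) ?A q y (\<lambda>_. 0)"
        unfolding in_visit_def
      proof (intro conjI ballI allI impI)
        show "y \<le> q (p (stage n))"
          using True by (simp add: x_def k_def)
      qed (use poll next_obs(1) in \<open>auto simp: at_poll_def completion_def x_def k_def\<close>)
      from service_phase_bound[OF \<nu> ac u c later this]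
      have "emeasure \<nu> ?A \<le> ennreal (c * C * (weight u (q(k := x - y)) * \<zeta> k ^ y)) * emeasure M ?A"
        by (simp add: k_def x_def)
      also have "c * C * (weight u (q(k := x - y)) * \<zeta> k ^ y) = W * (u k ^ (x - y) * \<zeta> k ^ y)"
        by (simp add: W_def weight_update[of u q k "x - y"])
      also have "ennreal (W * (u k ^ (x - y) * \<zeta> k ^ y)) * emeasure M ?A =
        ennreal W * emeasure M A * (ennreal (pmf ?b y) * ennreal (u k ^ (x - y) * \<zeta> k ^ y))"
        unfolding mass ennreal_mult'[OF W] by (simp only: mult_ac)
      finally show ?thesis .
    next
      \<comment> \<open>\<open>Y n x\<close> can exceed \<open>x\<close> only on a null set of
        \<open>M\<close>, which is also null for \<open>\<nu>\<close>.\<close>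
      case False
      then have "pmf ?b y = 0"
        using r_stage[of n] by simp
      then have "emeasure M ?A = 0"
        using mass by simp
      then have "?A \<in> null_sets M"
        using observableD(1)[OF next_obs(1)] by (auto simp: null_sets_def)
      then have "?A \<in> null_sets \<nu>"
        using ac by (auto simp: absolutely_continuous_def)
      then show ?thesis
        by (simp add: null_sets_def)
    qed
    then show ?thesis
      unfolding A_eq .
  qed
  have "emeasure \<nu> A = (\<integral>\<^sup>+y. emeasure \<nu> (A \<inter> {w\<in>space \<nu>. Y n x w = y}) \<partial>count_space UNIV)"
    by (rule emeasure_split_countable) (simp_all add: \<nu> measurable_cong_sets[OF \<nu> refl] Y_measurable)
  also have "\<dots> \<le> (\<integral>\<^sup>+y. ennreal W * emeasure M A * (ennreal (pmf ?b y) * ennreal (u k ^ (x - y) * \<zeta> k ^ y)) \<partial>count_space UNIV)"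
    by (intro nn_integral_mono step)
  also have "\<dots> = ennreal W * emeasure M A * (\<integral>\<^sup>+y. ennreal (u k ^ (x - y) * \<zeta> k ^ y) \<partial>measure_pmf ?b)"
    by (simp add: nn_integral_cmult nn_integral_measure_pmf)
  also have "\<dots> = ennreal W * emeasure M A * ennreal (((1 - r (stage n)) * u k + r (stage n) * \<zeta> k) ^ x)"
    by (subst nn_integral_binomial_pmf_power[OF r_stage u(1) \<zeta>_nonneg]) simp
  also have "\<dots> = ennreal (W * ((1 - r (stage n)) * u k + r (stage n) * \<zeta> k) ^ x) * emeasure M A"
    unfolding ennreal_mult'[OF W] by (simp only: mult_ac)
  also have "W * ((1 - r (stage n)) * u k + r (stage n) * \<zeta> k) ^ x = c * C * weight (visit_back n u) q"
    by (simp add: W_def visit_back_def k_def x_def weight_upd_base)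
  finally show ?thesis .
qed

text \<open>Bases at the start of visit \<open>n\<close> that account for the bases \<open>z\<close>
  after \<open>L\<close> visits; the recursion goes backwards in time, as the bounds do.\<close>

primrec cycle_back :: "nat \<Rightarrow> nat \<Rightarrow> 'b \<Rightarrow> real" where
  "cycle_back 0 n = z"
| "cycle_back (Suc L) n = visit_back n (cycle_back L (Suc n))"

text \<open>A convex combination with \<open>\<zeta> k\<close> stays in the interval. The lower
  bound is what shows that a further visit never raises a base.\<close>

lemma cycle_back_bounds: "\<zeta> k \<le> cycle_back L n k \<and> cycle_back L n k \<le> z k"
proof (induction L arbitrary: n)
  case 0
  then show ?case
    using \<zeta>_less[of k] by simp
next
  case (Suc L)
  let ?r = "r (stage n)" and ?v = "cycle_back L (Suc n) k"
  have r: "0 \<le> ?r" "?r \<le> 1"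
    using r_stage[of n] by auto
  have "?r * \<zeta> k \<le> ?r * ?v" "(1 - ?r) * \<zeta> k \<le> (1 - ?r) * ?v"
    using Suc[of "Suc n"] r by (intro mult_left_mono; simp)+
  moreover have "\<zeta> k = (1 - ?r) * \<zeta> k + ?r * \<zeta> k" "?v = (1 - ?r) * ?v + ?r * ?v"
    by (simp_all add: algebra_simps)
  ultimately have "\<zeta> k \<le> (1 - ?r) * ?v + ?r * \<zeta> k" "(1 - ?r) * ?v + ?r * \<zeta> k \<le> ?v"
    by linarith+
  then show ?case
    using Suc[of "Suc n"] by (auto simp: visit_back_def)
qed

text \<open>A visit with positive \<open>r\<close> mixes in a share of
  \<open>\<zeta> k < z k\<close>, and pulling back through other visits does not raise the base
  again.\<close>

lemma cycle_back_less:
  assumes "\<exists>i\<in>{n..<n + L}. p (stage i) = k \<and> 0 < r (stage i)"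
  shows "cycle_back L n k < z k"
  using assms
proof (induction L arbitrary: n)
  case (Suc L)
  let ?r = "r (stage n)" and ?v = "cycle_back L (Suc n) k"
  have r: "0 \<le> ?r" "?r \<le> 1"
    using r_stage[of n] by auto
  have v: "\<zeta> k \<le> ?v" "?v \<le> z k"
    using cycle_back_bounds by auto
  show ?case
  proof (cases "p (stage n) = k \<and> 0 < ?r")
    case True
    have "(1 - ?r) * ?v + ?r * \<zeta> k \<le> (1 - ?r) * z k + ?r * \<zeta> k"
      using r v by (intro add_right_mono mult_left_mono) auto
    also have "\<dots> < (1 - ?r) * z k + ?r * z k"
      using True \<zeta>_less[of k] by simp
    finally show ?thesis
      using True by (simp add: visit_back_def algebra_simps)
  next
    case False
    obtain i where i: "n \<le> i" "i < n + Suc L" "p (stage i) = k" "0 < r (stage i)"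
      using Suc.prems by auto
    with False have "i \<noteq> n"
      by auto
    with i have "\<exists>i\<in>{Suc n..<Suc n + L}. p (stage i) = k \<and> 0 < r (stage i)"
      by (intro bexI[of _ i]) auto
    from Suc.IH[OF this] have "?v < z k" .
    then show ?thesis
      using False r by (cases "p (stage n) = k") (auto simp: visit_back_def)
  qed
qed simp

lemma polling_weight_bound:
  assumes "at_poll n U \<tau> A q"
  shows "(\<integral>\<^sup>+w. ennreal (weight z (polling_queue (n + L) w)) * indicator A w \<partial>M) \<le>
    ennreal (C ^ L * weight (cycle_back L n) q) * emeasure M A"
  using assms
proof (induction L arbitrary: n U \<tau> A q)
  case 0
  have A: "A \<in> events"
    using 0 observableD(1) by (auto simp: at_poll_def)
  have "(\<integral>\<^sup>+w. ennreal (weight z (polling_queue (n + 0) w)) * indicator A w \<partial>M) =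
    (\<integral>\<^sup>+w. ennreal (weight z q) * indicator A w \<partial>M)"
    using 0 by (intro nn_integral_cong) (auto simp: at_poll_def indicator_def)
  also have "\<dots> = ennreal (weight z q) * emeasure M A"
    using A by (simp add: nn_integral_cmult_indicator)
  finally show ?case
    by simp
next
  case (Suc L)
  define f where "f w = ennreal (weight z (polling_queue (n + Suc L) w))" for w
  have f [measurable]: "f \<in> borel_measurable M"
    unfolding f_def by (rule measurable_compose[OF polling_queue_measurable]) simp
  \<comment> \<open>Under this density the measure of a set is the mean final weight on it, so the
    induction hypothesis is exactly the premise \<open>later\<close> of
    \<open>visit_bound\<close>.\<close>
  let ?\<nu> = "density M f"
  have [measurable]: "A \<in> events"
    using Suc.prems observableD(1) by (auto simp: at_poll_def)
  have "emeasure ?\<nu> A \<le> ennreal (C ^ L * C * weight (visit_back n (cycle_back L (Suc n))) q) * emeasure M A"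
  proof (rule visit_bound[OF _ _ _ _ _ _ Suc.prems])
    show "absolutely_continuous M ?\<nu>"
      using f by (rule absolutely_continuousI_density)
    show "0 \<le> cycle_back L (Suc n) k" "cycle_back L (Suc n) k \<le> z k" for k
      using cycle_back_bounds[of k L "Suc n"] \<zeta>_ge_1[of k] by auto
    show "0 \<le> C ^ L"
      using C_nonneg by simp
    fix U' \<tau>' A' q' assume poll: "at_poll (Suc n) U' \<tau>' A' q'"
    have "A' \<in> events"
      using poll observableD(1) by (auto simp: at_poll_def)
    then show "emeasure ?\<nu> A' \<le> ennreal (C ^ L * weight (cycle_back L (Suc n)) q') * emeasure M A'"
      using Suc.IH[OF poll] by (simp add: emeasure_density f_def)
  qed simp
  then show ?case
    by (simp add: emeasure_density f_def mult_ac)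
qed

section \<open>Stationarity\<close>

lemma X0_event [measurable]: "{w\<in>space M. X0 w = q} \<in> events"
  using X0_measurable by measurable

lemma nn_integral_split_X0:
  assumes g: "g \<in> borel_measurable M"
  shows "(\<integral>\<^sup>+w. g w \<partial>M) = (\<integral>\<^sup>+q. (\<integral>\<^sup>+w. g w * indicator {w\<in>space M. X0 w = q} w \<partial>M) \<partial>count_space UNIV)"
proof -
  have "(\<integral>\<^sup>+w. g w \<partial>M) = emeasure (density M g) (space M)"
    unfolding emeasure_density[OF g sets.top] by (intro nn_integral_cong) simp
  also have "\<dots> = (\<integral>\<^sup>+q. emeasure (density M g) (space M \<inter> {w\<in>space (density M g). X0 w = q}) \<partial>count_space UNIV)"
    using X0_measurable by (intro emeasure_split_countable) auto
  also have "\<dots> = (\<integral>\<^sup>+q. emeasure (density M g) {w\<in>space M. X0 w = q} \<partial>count_space UNIV)"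
    by (intro nn_integral_cong arg_cong2[where f=emeasure]) auto
  also have "\<dots> = (\<integral>\<^sup>+q. (\<integral>\<^sup>+w. g w * indicator {w\<in>space M. X0 w = q} w \<partial>M) \<partial>count_space UNIV)"
    using g by (intro nn_integral_cong emeasure_density X0_event)
  finally show ?thesis .
qed

text \<open>Conditioning in elementary form: \<open>X0\<close> takes countably many values, so
  bounds on the sets where it is constant, relative to their probabilities, add up to an
  unconditional bound.\<close>

lemma nn_integral_mono_X0:
  assumes g: "g \<in> borel_measurable M"
    and le: "\<And>q. (\<integral>\<^sup>+w. g w * indicator {w\<in>space M. X0 w = q} w \<partial>M) \<le> \<phi> q * emeasure M {w\<in>space M. X0 w = q}"
  shows "(\<integral>\<^sup>+w. g w \<partial>M) \<le> (\<integral>\<^sup>+w. \<phi> (X0 w) \<partial>M)"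
proof -
  have "(\<integral>\<^sup>+w. g w \<partial>M) \<le> (\<integral>\<^sup>+q. \<phi> q * emeasure M {w\<in>space M. X0 w = q} \<partial>count_space UNIV)"
    unfolding nn_integral_split_X0[OF g] by (intro nn_integral_mono le)
  also have "\<dots> = (\<integral>\<^sup>+q. (\<integral>\<^sup>+w. \<phi> (X0 w) * indicator {w\<in>space M. X0 w = q} w \<partial>M) \<partial>count_space UNIV)"
  proof (rule nn_integral_cong)
    fix q
    have "(\<integral>\<^sup>+w. \<phi> (X0 w) * indicator {w\<in>space M. X0 w = q} w \<partial>M) =
      (\<integral>\<^sup>+w. \<phi> q * indicator {w\<in>space M. X0 w = q} w \<partial>M)"
      by (intro nn_integral_cong) (auto simp: indicator_def)
    then show "\<phi> q * emeasure M {w\<in>space M. X0 w = q} =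
      (\<integral>\<^sup>+w. \<phi> (X0 w) * indicator {w\<in>space M. X0 w = q} w \<partial>M)"
      by (simp add: nn_integral_cmult_indicator)
  qed
  also have "\<dots> = (\<integral>\<^sup>+w. \<phi> (X0 w) \<partial>M)"
    by (rule nn_integral_split_X0[symmetric]) (rule measurable_compose[OF X0_measurable], simp)
  finally show ?thesis .
qed

text \<open>The initial state is the first step of every trace: it consumes the source
  \<open>Initial\<close> and lasts no time.\<close>

lemma at_poll_0: "at_poll 0 {Initial} (\<lambda>_. 0) {w\<in>space M. X0 w = q} q"
proof -
  have "{w\<in>space M. X0 w = q} \<in> source_sets Initial"
  proof -
    have "{w\<in>space M. X0 w = q} = X0 -` {q} \<inter> space M"
      by auto
    then show ?thesis
      by (auto simp: source_sets_def intro!: sigma_sets.Basic)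
  qed
  from observable_step(1)[OF observable_empty _ _ this, of "\<lambda>_. 0"]
  have "observable {Initial} (\<lambda>_. 0) (space M \<inter> {w\<in>space M. w \<in> {w\<in>space M. X0 w = q}})"
    by auto
  also have "space M \<inter> {w\<in>space M. w \<in> {w\<in>space M. X0 w = q}} = {w\<in>space M. X0 w = q}"
    by auto
  finally show ?thesis
    by (auto simp: at_poll_def polling_0)
qed

lemma polling_weight_measurable [measurable]: "(\<lambda>w. weight z (polling_queue n w)) \<in> borel_measurable M"
  by (rule measurable_compose[OF polling_queue_measurable]) simp

lemma X0_weight_measurable [measurable]: "(\<lambda>w. weight z (X0 w)) \<in> borel_measurable M"
  by (rule measurable_compose[OF X0_measurable]) simp

lemma polling_weight_bound_X0:
  "(\<integral>\<^sup>+w. ennreal (weight z (polling_queue n w)) * indicator {w\<in>space M. X0 w = q} w \<partial>M) \<le>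
    ennreal (C ^ n * weight (cycle_back n 0) q) * emeasure M {w\<in>space M. X0 w = q}"
  using polling_weight_bound[OF at_poll_0, of n q] by simp

lemma weight_z_ge_1: "1 \<le> weight z q"
proof -
  have "1 \<le> z k" for k
    using \<zeta>_ge_1[of k] \<zeta>_less[of k] by simp
  then show ?thesis
    unfolding weight_def by (intro prod_ge_1 one_le_power) auto
qed

lemma cycle_back_full_less: "cycle_back I 0 k < z k"
proof (rule cycle_back_less)
  have "\<exists>i\<in>{i\<in>{1..I}. p i = k}. 0 < r i"
  proof (rule ccontr)
    assume "\<not> ?thesis"
    then have "(\<Sum>i\<in>{i\<in>{1..I}. p i = k}. r i) \<le> 0"
      by (intro sum_nonpos) (auto simp: not_less)
    then show False
      using r_pos[of k] by simp
  qed
  then obtain i where i: "1 \<le> i" "i \<le> I" "p i = k" "0 < r i"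
    by auto
  \<comment> \<open>Visits are numbered from 0 and stages from 1, so stage \<open>i\<close> belongs
    to visit \<open>i - 1\<close>.\<close>
  then have "stage (i - 1) = i"
    by (simp add: stage_def)
  with i show "\<exists>i\<in>{0..<0 + I}. p (stage i) = k \<and> 0 < r (stage i)"
    by (intro bexI[of _ "i - 1"]) auto
qed

text \<open>As there are finitely many queues, the new bases are at most \<open>\<beta> < 1\<close>
  times the old ones. The gain, \<beta> to the power of the total number of customers, beats
  \<open>C ^ I\<close> once that number reaches \<open>n0\<close>; for fewer customers the left side
  is at most \<open>C ^ I * Z ^ n0\<close>.\<close>

lemma cycle_contraction:
  obtains D where "0 \<le> D" "\<And>q. C ^ I * weight (cycle_back I 0) q \<le> weight z q / 2 + D"
proof -
  define v where "v = cycle_back I 0"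
  define \<beta> where "\<beta> = Max (range (\<lambda>k. v k / z k))"
  define Z where "Z = Max (range z)"
  have v: "0 \<le> v k" "v k \<le> z k" for k
    using cycle_back_bounds[of k I 0] \<zeta>_ge_1[of k] by (auto simp: v_def)
  have z: "1 < z k" for k
    using \<zeta>_ge_1[of k] \<zeta>_less[of k] by simp
  have \<beta>_upper: "v k / z k \<le> \<beta>" for k
    unfolding \<beta>_def by (intro Max_ge) auto
  have \<beta>: "0 \<le> \<beta>" "\<beta> < 1"
  proof -
    \<comment> \<open>\<open>undefined\<close> stands for an arbitrary queue.\<close>
    have "0 \<le> v undefined / z undefined"
      using v(1)[of undefined] z[of undefined] by simp
    then show "0 \<le> \<beta>"
      using \<beta>_upper[of undefined] by linarith
    have "v k / z k < 1" for k
      using cycle_back_full_less[of k] z[of k] by (simp add: v_def)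
    then show "\<beta> < 1"
      unfolding \<beta>_def by (subst Max_less_iff) auto
  qed
  have Z: "z k \<le> Z" for k
    unfolding Z_def by (intro Max_ge) auto
  have Z_ge_1: "1 \<le> Z"
    using Z[of undefined] z[of undefined] by simp
  have v_bound: "weight v q \<le> \<beta> ^ sum q UNIV * weight z q" for q
  proof -
    have "v k \<le> \<beta> * z k" for k
      using \<beta>_upper[of k] z[of k] by (simp add: pos_divide_le_eq)
    then have "weight v q \<le> weight (\<lambda>k. \<beta> * z k) q"
      using v by (intro weight_mono) auto
    also have "\<dots> = \<beta> ^ sum q UNIV * weight z q"
      by (simp add: weight_def power_mult_distrib prod.distrib power_sum)
    finally show ?thesis .
  qed
  have "(\<lambda>n. C ^ I * \<beta> ^ n) \<longlonglongrightarrow> C ^ I * 0"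
    using \<beta> by (intro tendsto_mult LIMSEQ_realpow_zero tendsto_const) auto
  then have "\<forall>\<^sub>F n in sequentially. C ^ I * \<beta> ^ n < 1 / 2"
    by (intro order_tendstoD(2)) auto
  then obtain n0 where n0: "\<And>n. n0 \<le> n \<Longrightarrow> C ^ I * \<beta> ^ n < 1 / 2"
    unfolding eventually_sequentially by blast
  have C: "0 \<le> C ^ I"
    using C_nonneg by simp
  show ?thesis
  proof (rule that)
    show D: "0 \<le> C ^ I * Z ^ n0"
      using C Z_ge_1 by simp
    fix q
    show "C ^ I * weight (cycle_back I 0) q \<le> weight z q / 2 + C ^ I * Z ^ n0"
    proof (cases "n0 \<le> sum q UNIV")
      case True
      have "C ^ I * weight v q \<le> C ^ I * (\<beta> ^ sum q UNIV * weight z q)"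
        using C by (intro mult_left_mono v_bound)
      also have "\<dots> = (C ^ I * \<beta> ^ sum q UNIV) * weight z q"
        by simp
      also have "\<dots> \<le> 1 / 2 * weight z q"
        using n0[OF True] weight_z_ge_1[of q] by (intro mult_right_mono) auto
      finally show ?thesis
        using D by (simp add: v_def)
    next
      case False
      have "weight v q \<le> weight (\<lambda>_. Z) q"
        using v order_trans[OF v(2) Z] by (intro weight_mono) auto
      also have "\<dots> = Z ^ sum q UNIV"
        by (simp add: weight_def power_sum)
      also have "\<dots> \<le> Z ^ n0"
        using False Z_ge_1 by (intro power_increasing) auto
      finally have "C ^ I * weight v q \<le> C ^ I * Z ^ n0"
        using C by (intro mult_left_mono)
      then show ?thesis
        using weight_z_ge_1[of q] by (simp add: v_def)
    qed
  qed
qed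

text \<open>The mean weight cannot be subtracted from both sides of the drift inequality while it
  may be infinite. Truncated weights have finite means, which stationarity equates, and the
  resulting bound \<open>2 * D\<close> is free of the truncation level.\<close>

lemma stationary_weight_finite:
  assumes steady: steady_state
  shows "(\<integral>\<^sup>+w. ennreal (weight z (X0 w)) \<partial>M) < \<infinity>"
proof -
  obtain D where D: "0 \<le> D" "\<And>q. C ^ I * weight (cycle_back I 0) q \<le> weight z q / 2 + D"
    using cycle_contraction by blast
  let ?f = "\<lambda>w. weight z (X0 w)" and ?g = "\<lambda>w. weight z (polling_queue I w)"
  have f_nonneg: "0 \<le> ?f w" for w
    using weight_z_ge_1[of "X0 w"] by simp
  have trunc: "(\<integral>\<^sup>+w. ennreal (?f w) * indicator {w\<in>space M. ?f w \<le> real n} w \<partial>M) \<le> ennreal (2 * D)" for n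
  proof -
    let ?b = "real n"
    let ?m = "\<integral>\<^sup>+w. ennreal (min (?f w / 2 + D) ?b) \<partial>M"
    have q0: "polling_queue 0 = X0"
      by (simp add: fun_eq_iff polling_0)
    have "(\<integral>\<^sup>+w. ennreal (min (?f w) ?b) \<partial>M) =
        (\<integral>\<^sup>+q. ennreal (min (weight z q) ?b) \<partial>distr M (count_space UNIV) (polling_queue 0))"
      using polling_queue_measurable[of 0] by (subst nn_integral_distr) (auto simp: q0)
    also have "\<dots> = (\<integral>\<^sup>+q. ennreal (min (weight z q) ?b) \<partial>distr M (count_space UNIV) (polling_queue I))"
      using steady by (simp add: steady_state_def)
    also have "\<dots> = (\<integral>\<^sup>+w. ennreal (min (?g w) ?b) \<partial>M)"
      by (subst nn_integral_distr) auto
    \<comment> \<open>On each set where \<open>X0\<close> is constant, the mean of the minimum is at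
      most the minimum of the two bounds.\<close>
    also have "\<dots> \<le> ?m"
    proof (rule nn_integral_mono_X0[where \<phi>="\<lambda>q. ennreal (min (weight z q / 2 + D) ?b)"])
      fix q
      let ?X = "{w\<in>space M. X0 w = q}"
      have "(\<integral>\<^sup>+w. ennreal (min (?g w) ?b) * indicator ?X w \<partial>M) \<le> (\<integral>\<^sup>+w. ennreal (?g w) * indicator ?X w \<partial>M)"
        by (intro nn_integral_mono mult_right_mono ennreal_leI) auto
      also have "\<dots> \<le> ennreal (C ^ I * weight (cycle_back I 0) q) * emeasure M ?X"
        by (rule polling_weight_bound_X0)
      also have "\<dots> \<le> ennreal (weight z q / 2 + D) * emeasure M ?X"
        by (intro mult_right_mono ennreal_leI D) simp
      finally have 1: "(\<integral>\<^sup>+w. ennreal (min (?g w) ?b) * indicator ?X w \<partial>M) \<le> \<dots>" .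
      have "(\<integral>\<^sup>+w. ennreal (min (?g w) ?b) * indicator ?X w \<partial>M) \<le> (\<integral>\<^sup>+w. ennreal ?b * indicator ?X w \<partial>M)"
        by (intro nn_integral_mono mult_right_mono ennreal_leI) auto
      also have "\<dots> = ennreal ?b * emeasure M ?X"
        by (rule nn_integral_cmult_indicator) (rule X0_event)
      finally have 2: "(\<integral>\<^sup>+w. ennreal (min (?g w) ?b) * indicator ?X w \<partial>M) \<le> \<dots>" .
      show "(\<integral>\<^sup>+w. ennreal (min (?g w) ?b) * indicator ?X w \<partial>M) \<le>
          ennreal (min (weight z q / 2 + D) ?b) * emeasure M ?X"
        using 1 2 by (cases "weight z q / 2 + D \<le> ?b") (simp_all only: min_def if_True if_False)
    qed measurable
    finally have drift: "(\<integral>\<^sup>+w. ennreal (min (?f w) ?b) \<partial>M) \<le> ?m" .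
    have "?m \<le> (\<integral>\<^sup>+w. ennreal ?b \<partial>M)"
      by (intro nn_integral_mono ennreal_leI) auto
    then have m_finite: "?m < \<top>"
      by (simp add: emeasure_space_1 le_less_trans)
    have "?m + (\<integral>\<^sup>+w. ennreal (?f w / 2) * indicator {w\<in>space M. ?f w \<le> ?b} w \<partial>M) =
      (\<integral>\<^sup>+w. ennreal (min (?f w / 2 + D) ?b) + ennreal (?f w / 2) * indicator {w\<in>space M. ?f w \<le> ?b} w \<partial>M)"
      by (rule nn_integral_add[symmetric]) measurable
    \<comment> \<open>Pointwise: up to the level b, min (f / 2 + D) b + f / 2 \<le> f + D; above it,
      the left side is at most b = min f b. Cancelling the finite \<open>?m\<close> leaves the half
      weight.\<close>
    also have "\<dots> \<le> (\<integral>\<^sup>+w. ennreal (min (?f w) ?b) + ennreal D \<partial>M)"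
    proof (rule nn_integral_mono)
      fix w
      assume w: "w \<in> space M"
      show "ennreal (min (?f w / 2 + D) ?b) + ennreal (?f w / 2) * indicator {w\<in>space M. ?f w \<le> ?b} w \<le>
          ennreal (min (?f w) ?b) + ennreal D"
      proof (cases "?f w \<le> ?b")
        case True
        have "ennreal (min (?f w / 2 + D) ?b) + ennreal (?f w / 2) = ennreal (min (?f w / 2 + D) ?b + ?f w / 2)"
          using D(1) f_nonneg[of w] by (intro ennreal_plus[symmetric]) auto
        also have "\<dots> \<le> ennreal (?f w + D)"
          by (intro ennreal_leI) (auto simp: min_def)
        also have "\<dots> = ennreal (?f w) + ennreal D"
          using D(1) f_nonneg[of w] by (intro ennreal_plus)
        finally show ?thesis
          using True w by (simp add: min_absorb1)
      next
        case False
        then have "ennreal (min (?f w / 2 + D) ?b) \<le> ennreal (min (?f w) ?b)"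
          by (intro ennreal_leI) auto
        then show ?thesis
          using False by (simp add: add_increasing2)
      qed
    qed
    also have "\<dots> = (\<integral>\<^sup>+w. ennreal (min (?f w) ?b) \<partial>M) + ennreal D"
      by (subst nn_integral_add) (auto simp: emeasure_space_1)
    also have "\<dots> \<le> ?m + ennreal D"
      by (intro add_right_mono drift)
    finally have half: "(\<integral>\<^sup>+w. ennreal (?f w / 2) * indicator {w\<in>space M. ?f w \<le> ?b} w \<partial>M) \<le> ennreal D"
      using m_finite by (auto simp: ennreal_add_left_cancel_le)
    have "(\<integral>\<^sup>+w. ennreal (?f w) * indicator {w\<in>space M. ?f w \<le> ?b} w \<partial>M) =
      (\<integral>\<^sup>+w. 2 * (ennreal (?f w / 2) * indicator {w\<in>space M. ?f w \<le> ?b} w) \<partial>M)"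
    proof (rule nn_integral_cong)
      fix w
      have "ennreal (?f w) = ennreal (2 * (?f w / 2))"
        by simp
      also have "\<dots> = 2 * ennreal (?f w / 2)"
        by (subst ennreal_mult') auto
      finally show "ennreal (?f w) * indicator {w\<in>space M. ?f w \<le> ?b} w =
        2 * (ennreal (?f w / 2) * indicator {w\<in>space M. ?f w \<le> ?b} w)"
        by (simp add: mult.assoc)
    qed
    also have "\<dots> = 2 * (\<integral>\<^sup>+w. ennreal (?f w / 2) * indicator {w\<in>space M. ?f w \<le> ?b} w \<partial>M)"
      by (rule nn_integral_cmult) measurable
    also have "\<dots> \<le> 2 * ennreal D"
      by (intro mult_left_mono half) simp
    also have "\<dots> = ennreal (2 * D)"
      by (subst ennreal_mult') auto
    finally show ?thesis .
  qed
  let ?h = "\<lambda>n w. ennreal (?f w) * indicator {w\<in>space M. ?f w \<le> real n} w"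
  have "(\<integral>\<^sup>+w. ennreal (?f w) \<partial>M) = (\<integral>\<^sup>+w. (SUP n. ?h n w) \<partial>M)"
  proof (rule nn_integral_cong)
    fix w assume w: "w \<in> space M"
    obtain n where "?f w \<le> real n"
      using real_arch_simple by blast
    then have "?h n w = ennreal (?f w)"
      using w by simp
    moreover have "?h n w \<le> ennreal (?f w)" for n
      by (simp add: indicator_def)
    ultimately show "ennreal (?f w) = (SUP n. ?h n w)"
      by (intro antisym SUP_least SUP_upper2[of n]) auto
  qed
  also have "\<dots> = (SUP n. \<integral>\<^sup>+w. ?h n w \<partial>M)"
  proof (rule nn_integral_monotone_convergence_SUP)
    show "incseq ?h"
    proof (rule incseq_SucI, rule le_funI)
      fix n w
      show "?h n w \<le> ?h (Suc n) w"
        by (intro mult_left_mono) (auto simp: indicator_def)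
    qed
  qed measurable
  also have "\<dots> \<le> ennreal (2 * D)"
    by (intro SUP_least trunc)
  also have "\<dots> < \<infinity>"
    by simp
  finally show ?thesis .
qed

text \<open>Visit \<open>n\<close> is reached from time 0 at the cost of a factor \<open>C\<close>
  per visit, the pulled-back bases being at most \<open>z\<close>.\<close>

lemma polling_weight_finite:
  assumes steady: steady_state
  shows "(\<integral>\<^sup>+w. ennreal (weight z (polling_queue n w)) \<partial>M) < \<infinity>"
proof -
  have "(\<integral>\<^sup>+w. ennreal (weight z (polling_queue n w)) \<partial>M) \<le> (\<integral>\<^sup>+w. ennreal (C ^ n * weight z (X0 w)) \<partial>M)"
  proof (rule nn_integral_mono_X0[where \<phi>="\<lambda>q. ennreal (C ^ n * weight z q)"])
    fix q
    have "0 \<le> cycle_back n 0 k" "cycle_back n 0 k \<le> z k" for k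
      using cycle_back_bounds[of k n 0] \<zeta>_ge_1[of k] by auto
    then have "weight (cycle_back n 0) q \<le> weight z q"
      by (rule weight_mono)
    then have "ennreal (C ^ n * weight (cycle_back n 0) q) \<le> ennreal (C ^ n * weight z q)"
      using C_nonneg by (intro ennreal_leI mult_left_mono) auto
    then have "ennreal (C ^ n * weight (cycle_back n 0) q) * emeasure M {w\<in>space M. X0 w = q} \<le>
        ennreal (C ^ n * weight z q) * emeasure M {w\<in>space M. X0 w = q}"
      by (rule mult_right_mono) simp
    with polling_weight_bound_X0[of n q]
    show "(\<integral>\<^sup>+w. ennreal (weight z (polling_queue n w)) * indicator {w\<in>space M. X0 w = q} w \<partial>M) \<le>
        ennreal (C ^ n * weight z q) * emeasure M {w\<in>space M. X0 w = q}"
      by (rule order_trans)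
  qed measurable
  also have "\<dots> = ennreal (C ^ n) * (\<integral>\<^sup>+w. ennreal (weight z (X0 w)) \<partial>M)"
    using C_nonneg by (simp add: ennreal_mult' nn_integral_cmult)
  also have "\<dots> < \<infinity>"
    using stationary_weight_finite[OF steady] by (simp add: ennreal_mult_less_top)
  finally show ?thesis .
qed

lemma polling_moment_integrable:
  assumes steady: steady_state
  shows "integrable M (\<lambda>w. real (polling_queue n w k) ^ l)"
proof -
  have z: "1 \<le> z j" for j
    using \<zeta>_ge_1[of j] \<zeta>_less[of j] by simp
  have "1 < z k"
    using \<zeta>_ge_1[of k] \<zeta>_less[of k] by simp
  then obtain c where c: "0 \<le> c" "\<And>m. real m ^ l \<le> c * z k ^ m"
    using power_le_exponential[of "z k" l] by blast
  have bound: "real (q k) ^ l \<le> c * weight z q" for q :: "'b \<Rightarrow> nat"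
  proof -
    have "1 \<le> weight z (q(k := 0))"
      by (rule weight_z_ge_1)
    then have "z k ^ q k * 1 \<le> weight z q"
      using z[of k] unfolding weight_remove[of z q k] by (intro mult_left_mono) auto
    then have "c * z k ^ q k \<le> c * weight z q"
      using c(1) by (intro mult_left_mono) auto
    with c(2)[of "q k"] show ?thesis
      by (rule order_trans)
  qed
  show ?thesis
  proof (rule integrableI_bounded)
    show "(\<lambda>w. real (polling_queue n w k) ^ l) \<in> borel_measurable M"
      by (rule measurable_compose[OF polling_queue_measurable]) simp
    have "(\<integral>\<^sup>+w. ennreal (norm (real (polling_queue n w k) ^ l)) \<partial>M) \<le>
      (\<integral>\<^sup>+w. ennreal c * ennreal (weight z (polling_queue n w)) \<partial>M)"
    proof (rule nn_integral_mono)
      fix w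
      show "ennreal (norm (real (polling_queue n w k) ^ l)) \<le> ennreal c * ennreal (weight z (polling_queue n w))"
        using ennreal_leI[OF bound[of "polling_queue n w"]] c(1) by (simp add: ennreal_mult')
    qed
    also have "\<dots> = ennreal c * (\<integral>\<^sup>+w. ennreal (weight z (polling_queue n w)) \<partial>M)"
      by (rule nn_integral_cmult) measurable
    also have "\<dots> < \<infinity>"
      using polling_weight_finite[OF steady] by (simp add: ennreal_mult_less_top)
    finally show "(\<integral>\<^sup>+w. ennreal (norm (real (polling_queue n w k) ^ l)) \<partial>M) < \<infinity>" .
  qed
qed

end

section \<open>Existence of the drift\<close>

context bep_polling
begin

definition load :: real where
  "load = (\<Sum>k\<in>UNIV. lam k / mu k)"

text \<open>
  A busy period at queue \<open>k\<close> started by one customer brings the expected workload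
  \<open>(load - \<rho>\<^sub>k) / (1 - \<rho>\<^sub>k) < load\<close>, in units of \<open>1 / mu k\<close>, to the other queues, where
  \<open>\<rho>\<^sub>k = lam k / mu k\<close>; hence the base \<open>exp (load * \<epsilon> / mu k)\<close>.
\<close>

definition drift_rate :: "'k \<Rightarrow> real \<Rightarrow> real" where
  "drift_rate k \<epsilon> =
     (\<Sum>i\<in>UNIV. lam i * (((\<lambda>i. exp (\<epsilon> / mu i))(k := exp (load * \<epsilon> / mu k))) i - 1))"

lemma load_bounds: "0 < load" "load < 1"
  using lam_pos mu_pos stable by (auto simp: load_def intro!: sum_pos)

lemma drift_rate_0: "drift_rate k 0 = 0"
  by (simp add: drift_rate_def)

lemma drift_rate_nonneg:
  assumes "0 \<le> \<epsilon>"
  shows "0 \<le> drift_rate k \<epsilon>"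
  unfolding drift_rate_def
proof (intro sum_nonneg mult_nonneg_nonneg)
  fix i
  show "0 \<le> lam i"
    using lam_pos[of i] by simp
  show "0 \<le> ((\<lambda>i. exp (\<epsilon> / mu i))(k := exp (load * \<epsilon> / mu k))) i - 1"
    using assms mu_pos[of i] mu_pos[of k] load_bounds by simp
qed

text \<open>The deficit (1 - load) rho_k below \<open>load\<close> is the margin of the
  construction. It arises because arrivals at the visited queue are due in the same visit and hence
  count with the fraction \<open>load\<close> of their exponent.\<close>

lemma drift_rate_derivative:
  "(drift_rate k has_real_derivative load - (1 - load) * (lam k / mu k)) (at 0)"
proof -
  have "drift_rate k = (\<lambda>\<epsilon>. lam k * (exp (load * \<epsilon> / mu k) - 1) + (\<Sum>i\<in>UNIV - {k}. lam i * (exp (\<epsilon> / mu i) - 1)))"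
    unfolding drift_rate_def by (subst sum.remove[of UNIV k]) auto
  moreover have "((\<lambda>\<epsilon>. lam k * (exp (load * \<epsilon> / mu k) - 1) + (\<Sum>i\<in>UNIV - {k}. lam i * (exp (\<epsilon> / mu i) - 1)))
    has_real_derivative lam k * (load / mu k) + (\<Sum>i\<in>UNIV - {k}. lam i / mu i)) (at 0)"
    using mu_pos by (auto intro!: derivative_eq_intros sum.cong simp: less_imp_neq[symmetric])
  moreover have "lam k * (load / mu k) + (\<Sum>i\<in>UNIV - {k}. lam i / mu i) = load - (1 - load) * (lam k / mu k)"
  proof -
    have "load = lam k / mu k + (\<Sum>i\<in>UNIV - {k}. lam i / mu i)"
      unfolding load_def by (subst sum.remove[of UNIV k]) auto
    moreover have "lam k * (load / mu k) = load * (lam k / mu k)"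
      by simp
    ultimately show ?thesis
      unfolding left_diff_distrib by linarith
  qed
  ultimately show ?thesis
    by simp
qed

text \<open>At \<epsilon> = 0 the base and the bound of the moment generating function both equal 1.
  Their derivatives there are load / mu_k and (load - (1 - load) rho_k) / mu_k; the former is larger
  since load < 1.\<close>

lemma eventually_service_drift:
  assumes "\<exists>e>0. \<forall>t\<in>{-e<..<e}. integrable (S_law k) (\<lambda>x. exp (t * x))"
  shows "\<forall>\<^sub>F \<epsilon> in at_right 0. \<exists>b. 0 \<le> b \<and> b < exp (load * \<epsilon> / mu k) \<and>
    (\<integral>\<^sup>+x. ennreal (exp (drift_rate k \<epsilon> * x)) \<partial>S_law k) \<le> ennreal b"
proof -
  from assms obtain e where e: "0 < e" "\<And>t. t \<in> {-e<..<e} \<Longrightarrow> integrable (S_law k) (\<lambda>x. exp (t * x))"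
    by auto
  define \<delta> where "\<delta> = e / 2"
  have \<delta>: "0 < \<delta>" "integrable (S_law k) (\<lambda>x. exp (\<delta> * x))"
    using e(1) e(2)[of \<delta>] by (auto simp: \<delta>_def)
  obtain B where B: "0 \<le> B" "\<And>t. 0 \<le> t \<Longrightarrow> t \<le> \<delta> / 2 \<Longrightarrow>
      (\<integral>\<^sup>+x. ennreal (exp (t * x)) \<partial>S_law k) \<le> ennreal (1 + t * (1 / mu k) + B * t\<^sup>2)"
    using nonneg_law_mgf_bound[OF service_law \<delta>] by blast
  let ?t = "drift_rate k"
  let ?b = "\<lambda>\<epsilon>. 1 + ?t \<epsilon> * (1 / mu k) + B * (?t \<epsilon>)\<^sup>2"
  let ?gap = "\<lambda>\<epsilon>. exp (load * \<epsilon> / mu k) - ?b \<epsilon>"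
  have "(?gap has_real_derivative load / mu k - (load - (1 - load) * (lam k / mu k)) / mu k) (at 0)"
    using mu_pos[of k]
    by (auto intro!: derivative_eq_intros drift_rate_derivative simp: drift_rate_0)
  moreover have "load / mu k - (load - (1 - load) * (lam k / mu k)) / mu k > 0"
    using lam_pos[of k] mu_pos[of k] load_bounds by (simp add: field_simps)
  ultimately obtain d where d: "0 < d" "\<And>h. 0 < h \<Longrightarrow> h < d \<Longrightarrow> ?gap 0 < ?gap (0 + h)"
    using DERIV_pos_inc_right[of ?gap _ 0] by blast
  have "\<forall>\<^sub>F \<epsilon> in at_right 0. \<epsilon> < d"
    using d(1) by (auto simp: eventually_at_right_field)
  moreover have "\<forall>\<^sub>F \<epsilon> in at_right 0. 0 < (\<epsilon> :: real)"
    by (rule eventually_at_right_less)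
  moreover have "\<forall>\<^sub>F \<epsilon> in at_right 0. ?t \<epsilon> < \<delta> / 2"
  proof -
    have "(?t \<longlongrightarrow> ?t 0) (at 0)"
      using DERIV_isCont[OF drift_rate_derivative] by (simp add: isCont_def)
    then have "(?t \<longlongrightarrow> 0) (at_right 0)"
      unfolding drift_rate_0 by (rule filterlim_mono) (auto simp: at_le)
    then show ?thesis
      using \<delta>(1) by (intro order_tendstoD(2)[of ?t 0]) auto
  qed
  ultimately show ?thesis
  proof eventually_elim
    case (elim \<epsilon>)
    have t: "0 \<le> ?t \<epsilon>"
      using elim by (intro drift_rate_nonneg) auto
    show ?case
    proof (intro exI[of _ "?b \<epsilon>"] conjI)
      show "0 \<le> ?b \<epsilon>"
        using t B(1) mu_pos[of k] by simp
      show "?b \<epsilon> < exp (load * \<epsilon> / mu k)"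
        using d(2)[of \<epsilon>] elim by (simp add: drift_rate_0)
      show "(\<integral>\<^sup>+x. ennreal (exp (?t \<epsilon> * x)) \<partial>S_law k) \<le> ennreal (?b \<epsilon>)"
        using t elim by (intro B(2)) auto
    qed
  qed
qed

lemma drift_parameters:
  assumes service_mgf: "\<And>k. \<exists>e>0. \<forall>t\<in>{-e<..<e}. integrable (S_law k) (\<lambda>x. exp (t * x))"
    and switchover_mgf: "\<And>t i. 0 \<le> t \<Longrightarrow> i \<in> {1..I} \<Longrightarrow> integrable (V_law i) (\<lambda>x. exp (t * x))"
  obtains z \<zeta> C \<eta> where "bep_drift M I p lam mu S_law s V_law r X0 N S V Y z \<zeta> C \<eta>"
proof -
  have "\<forall>\<^sub>F \<epsilon> in at_right 0. \<forall>k. \<exists>b. 0 \<le> b \<and> b < exp (load * \<epsilon> / mu k) \<and>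
    (\<integral>\<^sup>+x. ennreal (exp (drift_rate k \<epsilon> * x)) \<partial>S_law k) \<le> ennreal b"
    by (intro eventually_all_finite eventually_service_drift service_mgf)
  with eventually_at_right_less[of "0 :: real"]
  have "\<forall>\<^sub>F \<epsilon> in at_right 0. 0 < \<epsilon> \<and> (\<forall>k. \<exists>b. 0 \<le> b \<and> b < exp (load * \<epsilon> / mu k) \<and>
    (\<integral>\<^sup>+x. ennreal (exp (drift_rate k \<epsilon> * x)) \<partial>S_law k) \<le> ennreal b)"
    by (rule eventually_conj)
  then obtain \<epsilon> where \<epsilon>: "0 < \<epsilon>" and "\<forall>k. \<exists>b. 0 \<le> b \<and> b < exp (load * \<epsilon> / mu k) \<and>
    (\<integral>\<^sup>+x. ennreal (exp (drift_rate k \<epsilon> * x)) \<partial>S_law k) \<le> ennreal b"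
    using eventually_happens'[OF trivial_limit_at_right_real[of 0]] by blast
  then obtain b where b: "\<And>k. 0 \<le> b k" "\<And>k. b k < exp (load * \<epsilon> / mu k)"
      "\<And>k. (\<integral>\<^sup>+x. ennreal (exp (drift_rate k \<epsilon> * x)) \<partial>S_law k) \<le> ennreal (b k)"
    by metis
  define z where "z k = exp (\<epsilon> / mu k)" for k
  define \<zeta> where "\<zeta> k = exp (load * \<epsilon> / mu k)" for k
  \<comment> \<open>Finitely many strict inequalities \<open>b k < \<zeta> k\<close> leave a common
    factor below 1.\<close>
  define \<eta> where "\<eta> = Max (range (\<lambda>k. b k / \<zeta> k))"
  let ?t = "\<Sum>i\<in>UNIV. lam i * (z i - 1)"
  \<comment> \<open>A sum of nonnegative terms dominates each of them, so one constant serves the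
    switchovers of all stages.\<close>
  define C where "C = (\<Sum>i\<in>{1..I}. \<integral>x. exp (?t * x) \<partial>V_law i)"
  have \<zeta>_pos: "0 < \<zeta> k" for k
    by (simp add: \<zeta>_def)
  have t: "0 \<le> ?t"
  proof (intro sum_nonneg mult_nonneg_nonneg)
    show "0 \<le> lam i" "0 \<le> z i - 1" for i
      using lam_pos[of i] mu_pos[of i] \<epsilon> by (simp_all add: z_def)
  qed
  have \<eta>_upper: "b k \<le> \<eta> * \<zeta> k" for k
  proof -
    have "b k / \<zeta> k \<le> \<eta>"
      unfolding \<eta>_def by (intro Max_ge) auto
    then show ?thesis
      using \<zeta>_pos[of k] by (simp add: pos_divide_le_eq)
  qed
  show ?thesis
  proof (rule that, unfold_locales)
    show "1 \<le> \<zeta> k" for k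
      using \<epsilon> mu_pos[of k] load_bounds by (simp add: \<zeta>_def)
    show "\<zeta> k < z k" for k
      using \<epsilon> mu_pos[of k] load_bounds by (simp add: \<zeta>_def z_def divide_strict_right_mono)
    show "0 \<le> \<eta>"
    proof -
      have "0 \<le> \<eta> * \<zeta> undefined"
        using order_trans[OF b(1) \<eta>_upper] .
      then show ?thesis
        using \<zeta>_pos[of undefined] by (simp add: zero_le_mult_iff)
    qed
    show "\<eta> < 1"
      unfolding \<eta>_def using b(2) \<zeta>_pos by (subst Max_less_iff) (auto simp: \<zeta>_def)
    show "0 \<le> C"
      unfolding C_def by (intro sum_nonneg integral_nonneg_AE) simp
    show "(\<integral>\<^sup>+w. ennreal (exp ((\<Sum>i\<in>UNIV. lam i * ((z(p (stage n) := \<zeta> (p (stage n)))) i - 1)) * S n j w)) \<partial>M)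
      \<le> ennreal (\<eta> * \<zeta> (p (stage n)))" for n j
    proof -
      have rate: "(\<Sum>i\<in>UNIV. lam i * ((z(p (stage n) := \<zeta> (p (stage n)))) i - 1)) = drift_rate (p (stage n)) \<epsilon>"
        unfolding drift_rate_def by (intro sum.cong) (auto simp: z_def \<zeta>_def)
      have "(\<integral>\<^sup>+w. ennreal (exp (drift_rate (p (stage n)) \<epsilon> * S n j w)) \<partial>M) =
        (\<integral>\<^sup>+x. ennreal (exp (drift_rate (p (stage n)) \<epsilon> * x)) \<partial>distr M borel (S n j))"
        using S_measurable by (subst nn_integral_distr) auto
      also have "\<dots> \<le> ennreal (b (p (stage n)))"
        unfolding S_distr stage_def[symmetric] by (rule b(3))
      also have "\<dots> \<le> ennreal (\<eta> * \<zeta> (p (stage n)))"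
        by (intro ennreal_leI \<eta>_upper)
      finally show ?thesis
        unfolding rate .
    qed
    show "(\<integral>\<^sup>+w. ennreal (exp (?t * V n w)) \<partial>M) \<le> ennreal C" for n
    proof -
      have "(\<integral>\<^sup>+w. ennreal (exp (?t * V n w)) \<partial>M) = (\<integral>\<^sup>+x. ennreal (exp (?t * x)) \<partial>distr M borel (V n))"
        using V_measurable by (subst nn_integral_distr) auto
      also have "\<dots> = (\<integral>\<^sup>+x. ennreal (exp (?t * x)) \<partial>V_law (stage n))"
        unfolding V_distr stage_def ..
      also have "\<dots> = ennreal (\<integral>x. exp (?t * x) \<partial>V_law (stage n))"
        using switchover_mgf[OF t stage_range] by (intro nn_integral_eq_integral) auto
      also have "\<dots> \<le> ennreal C"
        unfolding C_def using stage_range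
        by (intro ennreal_leI member_le_sum[where f="\<lambda>i. \<integral>x. exp (?t * x) \<partial>V_law i"]) (auto intro!: integral_nonneg_AE)
      finally show ?thesis .
    qed
  qed
qed

end

theorem theorem4p1:
  fixes M :: "'w measure"
    and I :: nat
    and p :: "nat \<Rightarrow> 'k :: finite"
    and lam mu :: "'k \<Rightarrow> real"
    and S_law :: "'k \<Rightarrow> real measure"
    and s :: "nat \<Rightarrow> real"
    and V_law :: "nat \<Rightarrow> real measure"
    and r :: "nat \<Rightarrow> real"
    and X0 :: "'w \<Rightarrow> 'k \<Rightarrow> nat"
    and N :: "'k \<Rightarrow> real \<Rightarrow> 'w \<Rightarrow> nat"
    and S :: "nat \<Rightarrow> nat \<Rightarrow> 'w \<Rightarrow> real"
    and V :: "nat \<Rightarrow> 'w \<Rightarrow> real"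
    and Y :: "nat \<Rightarrow> nat \<Rightarrow> 'w \<Rightarrow> nat"
  assumes model: "bep_polling M I p lam mu S_law s V_law r X0 N S V Y"
    and steady: "bep_polling.steady_state M I p X0 N S V Y"
    and service_mgf: "\<And>k. \<exists>\<epsilon>>0. \<forall>t\<in>{-\<epsilon><..<\<epsilon>}. integrable (S_law k) (\<lambda>x. exp (t * x))"
    and switchover_mgf: "\<And>t i. 0 \<le> t \<Longrightarrow> i \<in> {1..I} \<Longrightarrow> integrable (V_law i) (\<lambda>x. exp (t * x))"
  shows "\<forall>i\<in>{1..I}. \<forall>k. \<forall>l\<ge>1.
           integrable M (\<lambda>w. real (bep_polling.stage_queue I p X0 N S V Y i w k) ^ l)"
proof -
  interpret bep_polling M I p lam mu S_law s V_law r X0 N S V Y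
    by (rule model)
  obtain z \<zeta> C \<eta> where "bep_drift M I p lam mu S_law s V_law r X0 N S V Y z \<zeta> C \<eta>"
    using drift_parameters[OF service_mgf switchover_mgf] by blast
  then interpret bep_drift M I p lam mu S_law s V_law r X0 N S V Y z \<zeta> C \<eta> .
  show ?thesis
    unfolding stage_queue_def using polling_moment_integrable[OF steady] by blast
qed

end
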